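(* Let $p$ be an odd prime, let $n$ and $d$ be positive integers, and let $\mathbf{y}=(y_1,\ldots,y_d)$ and $\mathbf{x}=(x_1,\ldots,x_n)$ be vectors of independent algebraic variables. Let $B(\mathbf{y})\in\mathrm{Mat}_n(\mathbb{F}_p[\mathbf{y}]_1)$ be a skew-symmetric matrix of linear forms and let $B^\bullet(\mathbf{x})\in\mathrm{Mat}_{n\times d}(\mathbb{F}_p[\mathbf{x}]_1)$ be its adjoint. Write $\mathrm{irk}(B)=(I_1,\ldots,I_n)$ for the ideal rank vector of $B$, and $\mathrm{irk}(B^\bullet)=(J_1,\ldots,J_{\min\{n,d\}})$ for the ideal rank vector of $B^\bullet$. For each $k\in\{1,\ldots,n\}$ and $\ell\in\{1,\ldots,\min\{n,d\}\}$, the following are invariants of the isomorphism class of the group $G_B(\mathbb{F}_p)$: (1) the degrees and dimensions of $I_k$ and $J_\ell$; (2) the degrees and dimensions of the ideals in a primary decomposition of $I_k$ and $J_\ell$; (3) the degrees, the number of rational points, and the number of irreducible components of $\mathcal{V}_{\mathrm{aff}}(I_k)$ and $\mathcal{V}_{\mathrm{aff}}(J_\ell)$; (4) the dimensions of $\langle\mathcal{V}_{\mathrm{aff}}(I_k)\rangle_{\mathbb{F}_p}$ and $\langle\mathcal{V}_{\mathrm{aff}}(J_\ell)\rangle_{\mathbb{F}_p}$.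
   Context: Here $\mathbb{F}_p$ is the field of $p$ elements. For a field $K$ and a vector $\mathbf{z}$ of indeterminates, $K[\mathbf{z}]_1$ is the space of linear forms in the polynomial ring $K[\mathbf{z}]$; $\mathrm{Mat}_{m\times n}(K[\mathbf{z}]_1)$ is the space of matrices with $m$ rows and $n$ columns whose entries are in $K[\mathbf{z}]_1$, and $\mathrm{Mat}_n=\mathrm{Mat}_{n\times n}$. The group $G_B(\mathbb{F}_p)$. Let $V=\mathbb{F}_p^n$ and $W=\mathbb{F}_p^d$, and let $(f_1,\ldots,f_d)$ be the standard basis of $W$. The matrix $B$ defines the alternating map $t:V\times V\to W$, $t(v,v')=\sum_{i=1}^d \bigl(v^{\top}B(f_i)v'\bigr)f_i$, where $B(f_i)$ is $B(\mathbf{y})$ evaluated at $\mathbf{y}=f_i$. Then $G_B(\mathbb{F}_p)$ is the set $V\times W$ with the group operation $(v,w)\star(v',w')=\bigl(v+v',\,w+w'+\tfrac12 t(v,v')\bigr)$. The adjoint. Write $B(\mathbf{y})=\bigl(B_{ij}^{(1)}y_1+\cdots+B_{ij}^{(d)}y_d\bigr)_{ij}$ with $B_{ij}^{(\kappa)}\in\mathbb{F}_p$. The adjoint of $B(\mathbf{y})$ is $B^\bullet(\mathbf{x})=\bigl(\sum_{j=1}^n B_{ij}^{(\kappa)}x_j\bigr)_{i\kappa}\in\mathrm{Mat}_{n\times d}(\mathbb{F}_p[x_1,\ldots,x_n]_1)$. Ideal rank vector. For a matrix of linear forms $D(\mathbf{z})\in\mathrm{Mat}_{m\times n}(K[\mathbf{z}]_1)$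 and $1\leq k\leq N=\min\{m,n\}$, the $k$-th determinantal ideal $I_k(D)$ is the homogeneous ideal of $K[\mathbf{z}]$ generated by the $k\times k$ minors of $D(\mathbf{z})$. The ideal rank vector of $D$ is $\mathrm{irk}(D)=(I_1(D),\ldots,I_N(D))$. Varieties. For a homogeneous ideal $I$ of $K[z_1,\ldots,z_e]$, $\mathcal{V}_{\mathrm{aff}}(I)$ is the affine variety of $I$ in $K^e$ and $\mathcal{V}_{\mathrm{proj}}(I)$ is the corresponding projective variety in $\mathbb{P}^{e-1}(K)$. In the theorem $K=\mathbb{F}_p$. For a subset $X\subset K^e$, $\langle X\rangle_K$ is the $K$-span of $X$. Degree. Let $m$ be the dimension of $\mathcal{V}_{\mathrm{proj}}(I)$. The degree of a homogeneous ideal $I$ is the product of $m!$ and the leading coefficient of the Hilbert polynomial of $I$ (the polynomial that, for all large $s$, equals the dimension over $K$ of the degree-$s$ part of $K[z_1,\ldots,z_e]/I$). If $\mathcal{V}_{\mathrm{proj}}(I)$ is empty, then the degree of $I$ is $0$. Dimensions of ideals, and degrees and irreducible components of varieties, are meant in the usual sense of algebraic geometry. Primary decomposition. An ideal $I$ of a ring $R$ is primary if, whenever $ab\in I$ for $a,b\in R$, then $a\in I$ or there is a positive integer $i$ with $b^i\in I$. A primary decomposition of $I$ is an expression of $I$ as a finite intersection of primary ideals; it is minimal if the radicals of these primary ideals are pairwise distinct and none of them can be omitted. Homogeneous ideals of polynomial rings over a field have minimal primary decompositions, and any two minimal decompositions have the same cardinality. *)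

theory Defs
  imports
    "HOL-Algebra.Algebraic_Closure_Type"
    "HOL-Analysis.Cartesian_Space"
    "HOL-Library.Poly_Mapping"
    "HOL-Library.Extended_Nat"
    "Jordan_Normal_Form.Determinant"
begin

no_notation vec_index (infixl "$" 100)

text \<open>The polynomial ring $K[z_i : i \in e]$ is the whole type \<open>('e, 'k) mpoly\<close>; the
  variables are indexed by the finite type \<open>'e\<close> (so $e$ = \<open>CARD('e)\<close> $\geq 1$), and
  affine space $K^e$ is \<open>'k ^ 'e\<close>. The type \<open>'a ^ 'n ^ 'm\<close> consists of matrices
  with $m$ rows and $n$ columns.\<close>

type_synonym ('e, 'k) mpoly = "('e \<Rightarrow>\<^sub>0 nat) \<Rightarrow>\<^sub>0 'k"

definition peval :: "('e::finite, 'k::comm_ring_1) mpoly \<Rightarrow> 'k ^ 'e \<Rightarrow> 'k" where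
  "peval f x = (\<Sum>m \<in> Poly_Mapping.keys f.
     Poly_Mapping.lookup f m * (\<Prod>i\<in>UNIV. (x $ i) ^ Poly_Mapping.lookup m i))"

definition mdeg :: "('e::finite \<Rightarrow>\<^sub>0 nat) \<Rightarrow> nat" where
  "mdeg m = (\<Sum>i\<in>UNIV. Poly_Mapping.lookup m i)"

definition hom_poly :: "nat \<Rightarrow> ('e::finite, 'k::zero) mpoly \<Rightarrow> bool" where
  "hom_poly s f \<longleftrightarrow> (\<forall>m \<in> Poly_Mapping.keys f. mdeg m = s)"

definition linear_form :: "('e::finite, 'k::zero) mpoly \<Rightarrow> bool" where
  "linear_form f \<longleftrightarrow> hom_poly 1 f"

definition pscale :: "'k::field \<Rightarrow> ('e, 'k) mpoly \<Rightarrow> ('e, 'k) mpoly" where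
  "pscale c f = Poly_Mapping.map ((*) c) f"

lemma lookup_pscale: "Poly_Mapping.lookup (pscale c f) m = c * Poly_Mapping.lookup f m"
  by (simp add: pscale_def Poly_Mapping.map.rep_eq when_def)

interpretation mp: vector_space "pscale :: 'k::field \<Rightarrow> ('e, 'k) mpoly \<Rightarrow> ('e, 'k) mpoly"
  by unfold_locales
    (auto intro!: poly_mapping_eqI simp: lookup_pscale lookup_add algebra_simps)


section \<open>The group and the adjoint\<close>

definition tmap :: "('d::finite, 'k::field) mpoly ^ 'n ^ 'n \<Rightarrow> 'k ^ 'n \<Rightarrow> 'k ^ 'n \<Rightarrow> 'k ^ 'd" where
  "tmap B v v' = (\<chi> i. \<Sum>a\<in>UNIV. \<Sum>b\<in>UNIV. v $ a * peval (B $ a $ b) (axis i 1) * v' $ b)"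

definition G_group :: "('d::finite, 'k::field) mpoly ^ 'n ^ 'n \<Rightarrow> (('k ^ 'n) \<times> ('k ^ 'd)) monoid" where
  "G_group B = \<lparr>carrier = UNIV,
     monoid.mult = (\<lambda>(v, w) (v', w'). (v + v', w + w' + (1 / 2) *s tmap B v v')),
     one = (0, 0)\<rparr>"

definition adjoint_mat :: "('d::finite, 'k::field) mpoly ^ 'n ^ 'n \<Rightarrow> ('n, 'k) mpoly ^ 'd ^ 'n" where
  "adjoint_mat B = (\<chi> i \<kappa>. \<Sum>j\<in>UNIV.
     Poly_Mapping.single (Poly_Mapping.single j 1)
       (Poly_Mapping.lookup (B $ i $ j) (Poly_Mapping.single \<kappa> 1)))"


section \<open>Ideals\<close>

text \<open>Ideals of a commutative ring are its submodules, i.e. \<open>idl.subspace I\<close>; the ideal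
  generated by \<open>S\<close> is \<open>idl.span S\<close>.\<close>

interpretation idl: Modules.module "(*) :: 'a::comm_ring_1 \<Rightarrow> 'a \<Rightarrow> 'a"
  by unfold_locales (simp_all add: algebra_simps)

definition prime_idl :: "'a::comm_ring_1 set \<Rightarrow> bool" where
  "prime_idl P \<longleftrightarrow> idl.subspace P \<and> P \<noteq> UNIV \<and> (\<forall>a b. a * b \<in> P \<longrightarrow> a \<in> P \<or> b \<in> P)"

definition primary_idl :: "'a::comm_ring_1 set \<Rightarrow> bool" where
  "primary_idl Q \<longleftrightarrow> idl.subspace Q \<and> (\<forall>a b. a * b \<in> Q \<longrightarrow> a \<in> Q \<or> (\<exists>i>0. b ^ i \<in> Q))"

definition rad :: "'a::comm_ring_1 set \<Rightarrow> 'a set" where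
  "rad I = {a. \<exists>i>0. a ^ i \<in> I}"

definition homogeneous_idl :: "('e::finite, 'k::field) mpoly set \<Rightarrow> bool" where
  "homogeneous_idl I \<longleftrightarrow> idl.subspace I \<and> I = idl.span {f \<in> I. \<exists>s. hom_poly s f}"

definition min_primary_decomp :: "'a::comm_ring_1 set \<Rightarrow> 'a set set \<Rightarrow> bool" where
  "min_primary_decomp I Qs \<longleftrightarrow>
     finite Qs \<and> (\<forall>Q\<in>Qs. primary_idl Q) \<and> \<Inter>Qs = I \<and>
     inj_on rad Qs \<and> (\<forall>Q\<in>Qs. \<Inter>(Qs - {Q}) \<noteq> I)"

text \<open>Krull dimension of the quotient by \<open>I\<close>. (Only meaningful for proper ideals: the
  unit ideal gets the value 0.)\<close>

definition idl_dim :: "'a::comm_ring_1 set \<Rightarrow> enat" where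
  "idl_dim I = Sup {enat m | m. \<exists>P :: nat \<Rightarrow> 'a set.
     (\<forall>i\<le>m. prime_idl (P i) \<and> I \<subseteq> P i) \<and> (\<forall>i<m. P i \<subset> P (Suc i))}"

text \<open>A minor is the determinant of the submatrix given by a choice of \<open>k\<close> distinct rows
  \<open>r 0, \<dots>, r (k - 1)\<close> and \<open>k\<close> distinct columns. The index types are not ordered, so every
  order of the rows and of the columns is allowed; this changes a minor by a sign only.\<close>

definition minors :: "nat \<Rightarrow> 'a::comm_ring_1 ^ 'n ^ 'm \<Rightarrow> 'a set" where
  "minors k D = {det (Matrix.mat k k (\<lambda>(i, j). D $ r i $ c j)) | (r :: nat \<Rightarrow> 'm) (c :: nat \<Rightarrow> 'n).
     inj_on r {..<k} \<and> inj_on c {..<k}}"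

definition det_idl :: "'a::comm_ring_1 ^ 'n ^ 'm \<Rightarrow> nat \<Rightarrow> 'a set" where
  "det_idl D k = idl.span (minors k D)"

text \<open>The entries $I_1, \dots, I_N$ have the list positions $0, \dots, N - 1$.\<close>

definition irk :: "'a::comm_ring_1 ^ 'n ^ 'm \<Rightarrow> 'a set list" where
  "irk D = map (det_idl D) [1..<Suc (min CARD('m) CARD('n))]"


section \<open>Algebraic sets\<close>

text \<open>Irreducibility, components and dimension with respect to a topology given by its
  family \<open>C\<close> of closed sets.\<close>

definition irred_closed :: "'p set set \<Rightarrow> 'p set \<Rightarrow> bool" where
  "irred_closed C Z \<longleftrightarrow> Z \<in> C \<and> Z \<noteq> {} \<and>
     (\<forall>A\<in>C. \<forall>A'\<in>C. Z \<subseteq> A \<union> A' \<longrightarrow> Z \<subseteq> A \<or> Z \<subseteq> A')"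

definition irred_components :: "'p set set \<Rightarrow> 'p set \<Rightarrow> 'p set set" where
  "irred_components C V = {Z. irred_closed C Z \<and> Z \<subseteq> V \<and>
     (\<forall>Z'. irred_closed C Z' \<and> Z' \<subseteq> V \<and> Z \<subseteq> Z' \<longrightarrow> Z' = Z)}"

definition top_dim :: "'p set set \<Rightarrow> 'p set \<Rightarrow> enat" where
  "top_dim C V = Sup {enat m | m. \<exists>Z :: nat \<Rightarrow> 'p set.
     (\<forall>i\<le>m. irred_closed C (Z i) \<and> Z i \<subseteq> V) \<and> (\<forall>i<m. Z i \<subset> Z (Suc i))}"

definition zeros :: "('e::finite, 'l::field) mpoly set \<Rightarrow> ('l ^ 'e) set" where
  "zeros S = {x. \<forall>f\<in>S. peval f x = 0}"

text \<open>Sets in \<open>'l ^ 'e\<close> that are the zero set of polynomials with coefficients in the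
  subfield \<open>F\<close> of \<open>'l\<close>; for \<open>F = UNIV\<close> this is the usual Zariski topology.\<close>

definition aff_closed :: "'l::field set \<Rightarrow> ('l ^ 'e::finite) set set" where
  "aff_closed F = {zeros S | S. \<forall>f\<in>S. \<forall>m. Poly_Mapping.lookup f m \<in> F}"

text \<open>Points of projective space are the lines through the origin.\<close>

definition proj_zeros :: "('e::finite, 'l::field) mpoly set \<Rightarrow> ('l ^ 'e) set set" where
  "proj_zeros S = {vec.span {x} | x. x \<noteq> 0 \<and> x \<in> zeros S}"

definition proj_closed :: "('l::field ^ 'e::finite) set set set" where
  "proj_closed = {proj_zeros S | S. \<forall>f\<in>S. \<exists>s. hom_poly s f}"

text \<open>Varieties over the field \<open>'k\<close>, which need not be algebraically closed: \<open>Vaff_rat I\<close>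
  is the set of \<open>'k\<close>-rational points, and \<open>Vaff I\<close>, \<open>Vproj I\<close> are the sets of points over the
  algebraic closure. Dimension, emptiness, degree and components refer to the latter.\<close>

definition Vaff_rat :: "('e::finite, 'k::field) mpoly set \<Rightarrow> ('k ^ 'e) set" where
  "Vaff_rat I = zeros I"

definition Vaff :: "('e::finite, 'k::field) mpoly set \<Rightarrow> ('k alg_closure ^ 'e) set" where
  "Vaff I = zeros (Poly_Mapping.map to_ac ` I)"

definition Vproj :: "('e::finite, 'k::field) mpoly set \<Rightarrow> ('k alg_closure ^ 'e) set set" where
  "Vproj I = proj_zeros (Poly_Mapping.map to_ac ` I)"

text \<open>Components of \<open>Vaff I\<close> as a variety over \<open>'k\<close> (closed sets defined over \<open>'k\<close>), and
  its geometric components (closed sets defined over the algebraic closure).\<close>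

definition var_components :: "('e::finite, 'k::field) mpoly set \<Rightarrow> ('k alg_closure ^ 'e) set set" where
  "var_components I = irred_components (aff_closed (range to_ac)) (Vaff I)"

definition var_geom_components :: "('e::finite, 'k::field) mpoly set \<Rightarrow> ('k alg_closure ^ 'e) set set" where
  "var_geom_components I = irred_components (aff_closed UNIV) (Vaff I)"


section \<open>Degrees\<close>

definition eventual_poly :: "(nat \<Rightarrow> nat) \<Rightarrow> rat poly" where
  "eventual_poly h = (THE q. \<exists>s0. \<forall>s\<ge>s0. poly q (of_nat s) = of_nat (h s))"

text \<open>The dimension of the degree \<open>s\<close> part of the quotient by a homogeneous ideal.\<close>

definition hilbert_fun :: "('e::finite, 'k::field) mpoly set \<Rightarrow> nat \<Rightarrow> nat" where
  "hilbert_fun I s = mp.dim {f :: ('e, 'k) mpoly. hom_poly s f} - mp.dim {f \<in> I. hom_poly s f}"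

definition idl_degree :: "('e::finite, 'k::field) mpoly set \<Rightarrow> rat" where
  "idl_degree I = (if Vproj I = {} then 0
     else fact (the_enat (top_dim proj_closed (Vproj I)))
            * Polynomial.lead_coeff (eventual_poly (hilbert_fun I)))"

text \<open>The degree of an affine algebraic set is that of its projective closure, whose Hilbert
  function is the affine Hilbert function of the vanishing ideal.\<close>

definition aff_hilbert_fun :: "('e::finite, 'l::field) mpoly set \<Rightarrow> nat \<Rightarrow> nat" where
  "aff_hilbert_fun I s =
     mp.dim {f :: ('e, 'l) mpoly. \<forall>m\<in>Poly_Mapping.keys f. mdeg m \<le> s} -
     mp.dim {f \<in> I. \<forall>m\<in>Poly_Mapping.keys f. mdeg m \<le> s}"

definition vanishing_idl :: "('l::field ^ 'e::finite) set \<Rightarrow> ('e, 'l) mpoly set" where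
  "vanishing_idl V = {f. \<forall>x\<in>V. peval f x = 0}"

definition var_degree :: "('l::field ^ 'e::finite) set \<Rightarrow> rat" where
  "var_degree V = fact (the_enat (top_dim (aff_closed UNIV) V))
     * Polynomial.lead_coeff (eventual_poly (aff_hilbert_fun (vanishing_idl V)))"

text \<open>Minimal primary decompositions are not unique, and neither are the degrees of embedded
  components. The invariant is therefore the collection of all families of (degree, dimension)
  pairs that arise from minimal primary decompositions into homogeneous ideals.\<close>

definition primary_data :: "('e::finite, 'k::field) mpoly set \<Rightarrow> (rat \<times> enat) multiset set" where
  "primary_data I = {image_mset (\<lambda>Q. (idl_degree Q, idl_dim Q)) (mset_set Qs) | Qs.
     min_primary_decomp I Qs \<and> (\<forall>Q\<in>Qs. homogeneous_idl Q)}"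

end

theory Submission
  imports Defs "HOL-Number_Theory.Residues"
begin

no_notation fps_nth (infixl "$" 75)

declare One_nat_def [simp del]

text \<open>
  The map \<open>t\<close> is the commutator map of the group, and the idea is to recover it, up to linear
  changes of coordinates, from the group alone. Let \<open>\<phi>\<close> be an isomorphism. Commutators determine
  \<open>t'(\<alpha> g, \<alpha> h) = \<psi> (t(v, v'))\<close>, where \<open>\<alpha>\<close> is the first component of \<open>\<phi>\<close>, \<open>v\<close> and \<open>v'\<close> are the
  first components of \<open>g\<close> and \<open>h\<close>, and \<open>\<psi>\<close> is the second component of \<open>\<phi>\<close> on \<open>0 \<times> W\<close>. Because the
  field is the prime field, additive maps are linear. The map \<open>\<psi>\<close> is additive, and it is injective on the
  span of the values of \<open>t\<close>; hence it agrees there with an invertible matrix \<open>Q\<close>. The restriction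
  of \<open>\<alpha>\<close> to \<open>V \<times> 0\<close> is linear and induces an isomorphism of the quotients of \<open>V\<close> by the radicals
  of \<open>t\<close> and \<open>t'\<close>. It need not be invertible, because the part of the centre that comes from the
  radical can be mixed with \<open>W\<close>, but changing it by a map into the radical of \<open>t'\<close> makes it
  invertible and does not affect \<open>t'\<close>. The result is an isometry \<open>t'(P u, P v) = Q t(u, v)\<close>
  (\<open>group_iso_imp_isometry\<close>).

  On matrices of linear forms the isometry reads \<open>B(Q\<^sup>T y) = P\<^sup>T B'(y) P\<close> and
  \<open>P\<^sup>T B'\<^sup>\<bullet>(P x) = B\<^sup>\<bullet>(x) Q\<^sup>T\<close>. Multiplication by invertible matrices does not change determinantal
  ideals: the determinant is multilinear in the rows, so the minors of a product are linear
  combinations of minors of either factor. Therefore the determinantal ideals of \<open>B\<close> and \<open>B'\<close>,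
  and those of the adjoints, are carried to each other by invertible linear substitutions of the
  variables (\<open>det_idl_isometry\<close>, \<open>det_idl_isometry_adjoint\<close>).

  It remains to see that every quantity in question is invariant under an invertible linear
  substitution (\<open>lsub_invariants\<close>). Such a substitution is a ring automorphism, which gives the
  Krull dimension and the primary decompositions; it preserves degrees of monomials, which gives
  the Hilbert functions; and it induces invertible linear maps on affine and projective space, also
  over the algebraic closure, that are homeomorphisms of all the Zariski topologies involved.
\<close>

abbreviation id_mat :: "'a::zero_neq_one ^ 'n ^ 'n" where
  "id_mat \<equiv> Finite_Cartesian_Product.mat 1"

section \<open>Ring homomorphisms out of a polynomial ring\<close>

lemma mpoly_sum_monomials:
  fixes f :: "('e::finite, 'k::comm_monoid_add) mpoly"
  shows "f = (\<Sum>m\<in>Poly_Mapping.keys f. Poly_Mapping.single m (Poly_Mapping.lookup f m))"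
proof (rule poly_mapping_eqI)
  fix k
  have "(\<Sum>m\<in>Poly_Mapping.keys f. Poly_Mapping.lookup (Poly_Mapping.single m (Poly_Mapping.lookup f m)) k)
      = (\<Sum>m\<in>Poly_Mapping.keys f. if m = k then Poly_Mapping.lookup f k else 0)"
    by (rule sum.cong) (auto simp: lookup_single when_def)
  then show "Poly_Mapping.lookup f k =
      Poly_Mapping.lookup (\<Sum>m\<in>Poly_Mapping.keys f. Poly_Mapping.single m (Poly_Mapping.lookup f m)) k"
    by (simp add: lookup_sum sum.delta' in_keys_iff)
qed

lemma additive_eq_on_monomials:
  fixes F G :: "('e::finite, 'k::comm_monoid_add) mpoly \<Rightarrow> 'b::comm_monoid_add"
  assumes "\<And>f g. F (f + g) = F f + F g" "F 0 = 0"
    and "\<And>f g. G (f + g) = G f + G g" "G 0 = 0"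
    and "\<And>m c. F (Poly_Mapping.single m c) = G (Poly_Mapping.single m c)"
  shows "F f = G f"
proof -
  have "F (sum s A) = sum (F \<circ> s) A" "G (sum s A) = sum (G \<circ> s) A"
    for s :: "_ \<Rightarrow> ('e, 'k) mpoly" and A :: "('e \<Rightarrow>\<^sub>0 nat) set"
    using assms by (induction A rule: infinite_finite_induct) auto
  then show ?thesis
    using mpoly_sum_monomials[of f] assms(5) by (metis (no_types, lifting) comp_apply sum.cong)
qed

text \<open>Evaluation at \<open>a\<close> after mapping the coefficients with \<open>h\<close>. Evaluation at points, linear
  substitution and the extension of scalars to the algebraic closure are all of this form.\<close>

definition poly_ev :: "('k::comm_ring_1 \<Rightarrow> 'r::comm_ring_1) \<Rightarrow> ('e::finite \<Rightarrow> 'r) \<Rightarrow> ('e, 'k) mpoly \<Rightarrow> 'r" where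
  "poly_ev h a f = (\<Sum>m\<in>Poly_Mapping.keys f.
     h (Poly_Mapping.lookup f m) * (\<Prod>i\<in>UNIV. a i ^ Poly_Mapping.lookup m i))"

abbreviation var :: "'e::finite \<Rightarrow> ('e, 'k::comm_ring_1) mpoly" where
  "var i \<equiv> Poly_Mapping.single (Poly_Mapping.single i 1) 1"

lemma monomial_eq_prod_var:
  "Poly_Mapping.single m c =
     Poly_Mapping.single 0 c * (\<Prod>i\<in>UNIV. var i ^ Poly_Mapping.lookup m i)"
  for m :: "'e::finite \<Rightarrow>\<^sub>0 nat" and c :: "'k::comm_ring_1"
proof -
  have pow: "(var i :: ('e, 'k) mpoly) ^ n = Poly_Mapping.single (Poly_Mapping.single i n) 1" for i n
    by (induction n) (auto simp: mult_single single_add[symmetric] plus_1_eq_Suc)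
  have "(\<Prod>i\<in>A. var i ^ Poly_Mapping.lookup m i) =
      (Poly_Mapping.single (\<Sum>i\<in>A. Poly_Mapping.single i (Poly_Mapping.lookup m i)) 1 :: ('e, 'k) mpoly)" for A
    by (induction A rule: infinite_finite_induct) (auto simp: pow mult_single)
  moreover have "(\<Sum>i\<in>UNIV. Poly_Mapping.single i (Poly_Mapping.lookup m i)) = m"
    by (rule poly_mapping_eqI) (simp add: lookup_sum lookup_single when_def)
  ultimately show ?thesis by (simp add: mult_single)
qed

lemma (in comm_ring_hom) poly_ev_hom: "comm_ring_hom (poly_ev hom a)"
proof -
  have ext: "poly_ev hom a f =
      (\<Sum>m\<in>S. hom (Poly_Mapping.lookup f m) * (\<Prod>i\<in>UNIV. a i ^ Poly_Mapping.lookup m i))"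
    if "finite S" "Poly_Mapping.keys f \<subseteq> S" for f S
    unfolding poly_ev_def by (rule sum.mono_neutral_left) (use that in \<open>auto simp: in_keys_iff\<close>)
  have zero: "poly_ev hom a 0 = 0" by (simp add: poly_ev_def)
  have add: "poly_ev hom a (f + g) = poly_ev hom a f + poly_ev hom a g" for f g
    using Poly_Mapping.keys_add[of f g]
    by (simp add: ext[of "Poly_Mapping.keys f \<union> Poly_Mapping.keys g"] lookup_add hom_add
        distrib_right sum.distrib)
  have single: "poly_ev hom a (Poly_Mapping.single m c) =
      hom c * (\<Prod>i\<in>UNIV. a i ^ Poly_Mapping.lookup m i)" for m c
    by (cases "c = 0") (simp_all add: poly_ev_def)
  have mult0: "poly_ev hom a (Poly_Mapping.single m c * Poly_Mapping.single m' c') =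
      poly_ev hom a (Poly_Mapping.single m c) * poly_ev hom a (Poly_Mapping.single m' c')" for m c m' c'
    by (simp only: mult_single single hom_mult lookup_add power_add prod.distrib mult_ac)
  have mult1: "poly_ev hom a (Poly_Mapping.single m c * g) =
      poly_ev hom a (Poly_Mapping.single m c) * poly_ev hom a g" for m c g
    by (rule additive_eq_on_monomials[where f = g]) (auto simp: distrib_left add zero mult0)
  have "poly_ev hom a (f * g) = poly_ev hom a f * poly_ev hom a g" for f g
    by (rule additive_eq_on_monomials[where f = f]) (auto simp: distrib_right add zero mult1)
  moreover have "poly_ev hom a 1 = 1"
    using single[of 0 1] by simp
  ultimately show ?thesis
    by unfold_locales (auto simp: add zero)
qed

lemma (in comm_ring_hom) poly_ev_monomial:
  "poly_ev hom a (Poly_Mapping.single m c) = hom c * (\<Prod>i\<in>UNIV. a i ^ Poly_Mapping.lookup m i)"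
  by (cases "c = 0") (simp_all add: poly_ev_def)

lemma (in comm_ring_hom) poly_ev_const: "poly_ev hom a (Poly_Mapping.single 0 c) = hom c"
  by (simp add: poly_ev_monomial)

lemma (in comm_ring_hom) poly_ev_var: "poly_ev hom a (Poly_Mapping.single (Poly_Mapping.single i 1) c) = hom c * a i"
proof -
  have "(\<Prod>j\<in>UNIV. a j ^ Poly_Mapping.lookup (Poly_Mapping.single i 1) j) = (\<Prod>j\<in>UNIV. if j = i then a i else 1)"
    by (rule prod.cong) (auto simp: lookup_single when_def)
  then show ?thesis by (simp add: poly_ev_monomial)
qed

text \<open>Identities between composites of substitutions, evaluations and coefficient maps are all proved
  with this uniqueness statement: only constants and variables have to be compared.\<close>

lemma poly_hom_eqI:
  fixes F G :: "('e::finite, 'k::comm_ring_1) mpoly \<Rightarrow> 'r::comm_ring_1"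
  assumes F: "comm_ring_hom F" and G: "comm_ring_hom G"
    and "\<And>c. F (Poly_Mapping.single 0 c) = G (Poly_Mapping.single 0 c)"
    and "\<And>i. F (var i) = G (var i)"
  shows "F f = G f"
proof -
  interpret F: comm_ring_hom F by fact
  interpret G: comm_ring_hom G by fact
  have "F (Poly_Mapping.single m c) = G (Poly_Mapping.single m c)" for m c
    by (simp only: arg_cong[OF monomial_eq_prod_var, of F m c] arg_cong[OF monomial_eq_prod_var, of G m c]
      F.hom_mult G.hom_mult F.hom_prod G.hom_prod F.hom_power G.hom_power assms(3,4))
  then show ?thesis
    by - (rule additive_eq_on_monomials[where f = f], auto simp: F.hom_add G.hom_add)
qed

lemma comm_ring_hom_comp: "comm_ring_hom f \<Longrightarrow> comm_ring_hom g \<Longrightarrow> comm_ring_hom (\<lambda>x. f (g x))"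
  for f :: "'b::comm_ring_1 \<Rightarrow> 'c::comm_ring_1" and g :: "'a::comm_ring_1 \<Rightarrow> 'b"
proof -
  assume "comm_ring_hom f" "comm_ring_hom g"
  then interpret f: comm_ring_hom f + g: comm_ring_hom g .
  show ?thesis by unfold_locales (auto simp: f.hom_add g.hom_add f.hom_mult g.hom_mult)
qed

lemma const_hom: "comm_ring_hom (Poly_Mapping.single 0 :: 'k::comm_ring_1 \<Rightarrow> ('e::finite, 'k) mpoly)"
  by unfold_locales (auto simp: single_add mult_single)

lemma to_ac_hom: "comm_ring_hom (to_ac :: 'k::field \<Rightarrow> _)"
  by unfold_locales auto

lemma id_comm_ring_hom: "comm_ring_hom (\<lambda>x. x :: 'k::comm_ring_1)"
  by unfold_locales auto

lemma peval_eq_poly_ev: "peval f x = poly_ev (\<lambda>c. c) (\<lambda>i. x $ i) f"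
  by (simp add: peval_def poly_ev_def)

section \<open>Linear substitutions\<close>

text \<open>The substitution \<open>f(z) \<mapsto> f(M z)\<close>.\<close>

definition lsub :: "'k::comm_ring_1 ^ 'e ^ 'e \<Rightarrow> ('e::finite, 'k) mpoly \<Rightarrow> ('e, 'k) mpoly" where
  "lsub M = poly_ev (Poly_Mapping.single 0)
     (\<lambda>i. \<Sum>j\<in>UNIV. Poly_Mapping.single (Poly_Mapping.single j 1) (M $ i $ j))"

lemma lsub_hom: "comm_ring_hom (lsub M)"
  unfolding lsub_def by (rule comm_ring_hom.poly_ev_hom[OF const_hom])

lemma lsub_const: "lsub M (Poly_Mapping.single 0 c) = Poly_Mapping.single 0 c"
  unfolding lsub_def by (rule comm_ring_hom.poly_ev_const[OF const_hom])

lemma lsub_mdeg_1_imp_singlemial: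
  "lsub M (Poly_Mapping.single (Poly_Mapping.single i 1) c) =
    (\<Sum>j\<in>UNIV. Poly_Mapping.single (Poly_Mapping.single j 1) (c * M $ i $ j))"
  unfolding lsub_def comm_ring_hom.poly_ev_var[OF const_hom] by (simp add: sum_distrib_left mult_single)

lemma single_sum: "Poly_Mapping.single m (\<Sum>i\<in>A. f i) = (\<Sum>i\<in>A. Poly_Mapping.single m (f i))"
  for f :: "_ \<Rightarrow> 'k::comm_ring_1"
  by (induction A rule: infinite_finite_induct) (auto simp: single_add)

text \<open>Substitution is pullback along the linear map, so the order of the product is reversed.\<close>

lemma lsub_lsub: "lsub M (lsub N f) = lsub (N ** M) f"
proof (rule poly_hom_eqI[where f = f])
  interpret comm_ring_hom "lsub M" by (rule lsub_hom)
  fix i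
  show "lsub M (lsub N (var i)) = lsub (N ** M) (var i)"
    unfolding lsub_mdeg_1_imp_singlemial hom_sum
    by (subst sum.swap) (simp add: matrix_matrix_mult_def single_sum)
qed (auto simp: lsub_const intro: lsub_hom comm_ring_hom_comp)

lemma lsub_1: "lsub (id_mat) f = f"
proof (rule poly_hom_eqI[where f = f])
  fix i :: 'a
  have "(\<Sum>j\<in>UNIV. Poly_Mapping.single (Poly_Mapping.single j 1) ((id_mat :: 'b ^ 'a ^ 'a) $ i $ j)) =
     (\<Sum>j\<in>UNIV. if j = i then var i else 0)"
    by (rule sum.cong) (auto simp: Finite_Cartesian_Product.mat_def)
  then show "lsub (id_mat) (var i) = (var i :: ('a, 'b) mpoly)"
    unfolding lsub_mdeg_1_imp_singlemial by simp
qed (auto simp: lsub_const intro: lsub_hom id_comm_ring_hom)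

lemma peval_hom: "comm_ring_hom (\<lambda>f. peval f x)"
  unfolding peval_eq_poly_ev by (rule comm_ring_hom.poly_ev_hom[OF id_comm_ring_hom])

lemma peval_mdeg_1_imp_singlemial: "peval (Poly_Mapping.single (Poly_Mapping.single i 1) c) x = c * x $ i"
  unfolding peval_eq_poly_ev by (rule comm_ring_hom.poly_ev_var[OF id_comm_ring_hom])

lemma peval_const: "peval (Poly_Mapping.single 0 c) x = c"
  unfolding peval_eq_poly_ev by (rule comm_ring_hom.poly_ev_const[OF id_comm_ring_hom])

lemma peval_lsub: "peval (lsub M f) x = peval f (M *v x)"
proof (rule poly_hom_eqI[where f = f])
  interpret comm_ring_hom "\<lambda>f. peval f x" by (rule peval_hom)
  show "peval (lsub M (var i)) x = peval (var i) (M *v x)" for i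
    unfolding lsub_mdeg_1_imp_singlemial hom_sum peval_mdeg_1_imp_singlemial
    by (simp add: matrix_vector_mult_def)
qed (auto simp: lsub_const peval_const intro: peval_hom comm_ring_hom_comp lsub_hom)

abbreviation map_ac :: "('e::finite, 'k::field) mpoly \<Rightarrow> ('e, 'k alg_closure) mpoly" where
  "map_ac \<equiv> Poly_Mapping.map to_ac"

lemma lookup_map_ac: "Poly_Mapping.lookup (map_ac f) m = to_ac (Poly_Mapping.lookup f m)"
  by (simp add: Poly_Mapping.map.rep_eq when_def)

lemma map_ac_hom: "comm_ring_hom (map_ac :: ('e::finite, 'k::field) mpoly \<Rightarrow> _)"
proof -
  interpret c: comm_ring_hom "\<lambda>c :: 'k. Poly_Mapping.single 0 (to_ac c) :: ('e, 'k alg_closure) mpoly"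
    by (rule comm_ring_hom_comp[OF const_hom to_ac_hom])
  interpret e: comm_ring_hom "poly_ev (\<lambda>c :: 'k. Poly_Mapping.single 0 (to_ac c)) var :: _ \<Rightarrow> ('e, 'k alg_closure) mpoly"
    by (rule c.poly_ev_hom)
  have "map_ac f = poly_ev (\<lambda>c :: 'k. Poly_Mapping.single 0 (to_ac c)) var f" for f :: "('e, 'k) mpoly"
  proof (rule additive_eq_on_monomials[where f = f])
    show "map_ac (Poly_Mapping.single m c) = poly_ev (\<lambda>c. Poly_Mapping.single 0 (to_ac c)) var (Poly_Mapping.single m c)"
      for m :: "'e \<Rightarrow>\<^sub>0 nat" and c :: 'k
      by (simp only: c.poly_ev_monomial monomial_eq_prod_var[symmetric])
         (auto intro!: poly_mapping_eqI simp: lookup_single when_def lookup_map_ac)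
  qed (auto intro!: poly_mapping_eqI simp: lookup_map_ac lookup_add e.hom_add)
  then have "map_ac = (poly_ev (\<lambda>c :: 'k. Poly_Mapping.single 0 (to_ac c)) var :: ('e, 'k) mpoly \<Rightarrow> _)" by blast
  then show ?thesis by (simp add: e.comm_ring_hom_axioms)
qed

definition mat_ac :: "'k::field ^ 'e ^ 'f \<Rightarrow> 'k alg_closure ^ 'e ^ 'f" where
  "mat_ac M = (\<chi> i j. to_ac (M $ i $ j))"

lemma map_ac_single: "map_ac (Poly_Mapping.single m c) = Poly_Mapping.single m (to_ac c)"
  by (auto intro!: poly_mapping_eqI simp: lookup_single when_def lookup_map_ac)

lemma map_ac_lsub: "map_ac (lsub M f) = lsub (mat_ac M) (map_ac f)"
proof (rule poly_hom_eqI[where f = f])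
  interpret comm_ring_hom "map_ac :: ('a, 'b) mpoly \<Rightarrow> _" by (rule map_ac_hom)
  show "map_ac (lsub M (var i)) = lsub (mat_ac M) (map_ac (var i))" for i
    unfolding map_ac_single lsub_mdeg_1_imp_singlemial hom_sum
    by (simp add: mat_ac_def)
qed (auto simp: lsub_const map_ac_single intro: comm_ring_hom_comp map_ac_hom lsub_hom)

lemma mat_ac_mult: "mat_ac (M ** N) = mat_ac M ** mat_ac N"
  by (simp add: Finite_Cartesian_Product.vec_eq_iff mat_ac_def matrix_matrix_mult_def to_ac_sum)

lemma mat_ac_1: "mat_ac (id_mat) = id_mat"
  by (simp only: mat_ac_def Finite_Cartesian_Product.mat_def Finite_Cartesian_Product.vec_eq_iff vec_lambda_beta) auto

lemma lsub_pscale: "lsub M (pscale c f) = pscale c (lsub M f)"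
proof -
  interpret comm_ring_hom "lsub M" by (rule lsub_hom)
  show ?thesis by (simp add: pscale_def mult_map_scale_conv_mult hom_mult lsub_const)
qed

lemma lsub_linear: "Vector_Spaces.linear pscale pscale (lsub M)"
proof -
  interpret comm_ring_hom "lsub M" by (rule lsub_hom)
  show ?thesis by unfold_locales (simp_all add: hom_add lsub_pscale)
qed

lemma hom_poly_sum: "(\<And>i. i \<in> A \<Longrightarrow> hom_poly s (f i)) \<Longrightarrow> hom_poly s (\<Sum>i\<in>A. f i)"
  using keys_sum[of f A] unfolding hom_poly_def by blast

lemma hom_poly_mult: "hom_poly s f \<Longrightarrow> hom_poly t g \<Longrightarrow> hom_poly (s + t) (f * g)"
  using Poly_Mapping.keys_mult[of f g] unfolding hom_poly_def
  by (force simp: mdeg_def lookup_add sum.distrib)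

lemma hom_poly_single: "mdeg m = s \<Longrightarrow> hom_poly s (Poly_Mapping.single m c)"
  by (simp add: hom_poly_def)

lemma hom_poly_1: "hom_poly 0 1"
  by (simp add: hom_poly_def mdeg_def)

lemma hom_poly_prod:
  "(\<And>i. i \<in> A \<Longrightarrow> hom_poly (s i) (f i)) \<Longrightarrow> finite A \<Longrightarrow> hom_poly (\<Sum>i\<in>A. s i) (\<Prod>i\<in>A. f i)"
  by (induction A rule: infinite_finite_induct)
     (auto intro: hom_poly_mult simp: hom_poly_1)

lemma hom_poly_power: "hom_poly s f \<Longrightarrow> hom_poly (n * s) (f ^ n)"
  by (induction n) (auto intro: hom_poly_mult simp: hom_poly_1)

lemma mdeg_var: "mdeg (Poly_Mapping.single i 1) = 1"
  by (simp add: mdeg_def lookup_single when_def)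

lemma hom_poly_lsub_monomial: "hom_poly (mdeg m) (lsub M (Poly_Mapping.single m c))"
proof -
  have "hom_poly (0 + (\<Sum>i\<in>UNIV. Poly_Mapping.lookup m i * 1)) (lsub M (Poly_Mapping.single m c))"
    unfolding lsub_def comm_ring_hom.poly_ev_monomial[OF const_hom]
    by (intro hom_poly_mult hom_poly_prod hom_poly_power hom_poly_sum hom_poly_single)
       (simp_all add: mdeg_var mdeg_def[of 0])
  then show ?thesis by (simp add: mdeg_def)
qed

text \<open>A linear substitution sends a monomial to a form of the same degree; so it introduces no new
  degrees. This controls homogeneous parts and degree filtrations at the same time.\<close>

lemma keys_lsub:
  assumes "m' \<in> Poly_Mapping.keys (lsub M f)"
  shows "\<exists>m\<in>Poly_Mapping.keys f. mdeg m' = mdeg m"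
proof -
  interpret comm_ring_hom "lsub M" by (rule lsub_hom)
  have "lsub M f = (\<Sum>m\<in>Poly_Mapping.keys f. lsub M (Poly_Mapping.single m (Poly_Mapping.lookup f m)))"
    by (subst mpoly_sum_monomials[of f]) (rule hom_sum)
  with assms obtain m where "m \<in> Poly_Mapping.keys f"
      "m' \<in> Poly_Mapping.keys (lsub M (Poly_Mapping.single m (Poly_Mapping.lookup f m)))"
    using keys_sum by (metis (no_types, lifting) UN_E subsetD)
  with hom_poly_lsub_monomial[of m M] show ?thesis unfolding hom_poly_def by blast
qed

section \<open>Homeomorphisms\<close>

text \<open>A homeomorphism of the topology with closed sets \<open>C\<close>, together with its inverse.\<close>

locale top_automorphism =
  fixes C :: "'p set set" and h g :: "'p \<Rightarrow> 'p"
  assumes gh: "g (h x) = x" and hg: "h (g x) = x"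
    and h_closed: "Z \<in> C \<Longrightarrow> h ` Z \<in> C" and g_closed: "Z \<in> C \<Longrightarrow> g ` Z \<in> C"
begin

lemma sym: "top_automorphism C g h"
  by unfold_locales (auto simp: gh hg h_closed g_closed)

lemma gh_image: "g ` h ` Z = Z" and hg_image: "h ` g ` Z = Z"
  by (auto simp: image_image gh hg)

lemma image_subset_iff_preimage: "h ` Z \<subseteq> A \<longleftrightarrow> Z \<subseteq> g ` A"
  using gh hg by (metis gh_image hg_image image_mono)

lemma irred_closed_image: "irred_closed C Z \<Longrightarrow> irred_closed C (h ` Z)"
  unfolding irred_closed_def image_subset_iff_preimage image_Un
  using h_closed g_closed by simp

lemma components_image_subset: "(`) h ` irred_components C V \<subseteq> irred_components C (h ` V)"
proof
  interpret s: top_automorphism C g h by (rule sym)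
  fix Y assume "Y \<in> (`) h ` irred_components C V"
  then obtain Z where Y: "Y = h ` Z" and Z: "irred_closed C Z" "Z \<subseteq> V"
    and max: "\<And>Z'. irred_closed C Z' \<Longrightarrow> Z' \<subseteq> V \<Longrightarrow> Z \<subseteq> Z' \<Longrightarrow> Z' = Z"
    by (auto simp: irred_components_def)
  have "Z' = Y" if "irred_closed C Z'" "Z' \<subseteq> h ` V" "Y \<subseteq> Z'" for Z'
    using max[of "g ` Z'"] that s.irred_closed_image[of Z'] s.image_subset_iff_preimage[of Z' V]
    by (metis Y hg_image image_subset_iff_preimage)
  with Y Z show "Y \<in> irred_components C (h ` V)"
    by (auto simp: irred_components_def irred_closed_image)
qed

lemma card_components_image: "card (irred_components C (h ` V)) = card (irred_components C V)"
proof -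
  interpret s: top_automorphism C g h by (rule sym)
  have "irred_components C (h ` V) = (`) h ` irred_components C V"
  proof
    show "irred_components C (h ` V) \<subseteq> (`) h ` irred_components C V"
    proof
      fix Y assume "Y \<in> irred_components C (h ` V)"
      then have "g ` Y \<in> irred_components C V"
        using s.components_image_subset[of "h ` V"] by (auto simp: gh_image)
      then show "Y \<in> (`) h ` irred_components C V"
        by (metis hg_image imageI)
    qed
  qed (rule components_image_subset)
  moreover have "inj ((`) h)"
    by (metis gh_image injI)
  ultimately show ?thesis
    by (metis card_image inj_on_subset subset_UNIV)
qed

lemma top_dim_le_image: "top_dim C V \<le> top_dim C (h ` V)"
  unfolding top_dim_def
proof (rule Sup_subset_mono, rule Collect_mono, safe)
  fix m and Z :: "nat \<Rightarrow> 'p set"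
  assume Z: "\<forall>i\<le>m. irred_closed C (Z i) \<and> Z i \<subseteq> V" "\<forall>i<m. Z i \<subset> Z (Suc i)"
  have "h ` A \<subset> h ` A'" if "A \<subset> A'" for A A'
    using that by (metis gh_image image_mono psubset_eq)
  with Z show "\<exists>m'. enat m = enat m' \<and> (\<exists>Z. (\<forall>i\<le>m'. irred_closed C (Z i) \<and> Z i \<subseteq> h ` V) \<and>
      (\<forall>i<m'. Z i \<subset> Z (Suc i)))"
    by (intro exI[of _ m] conjI refl exI[of _ "\<lambda>i. h ` Z i"])
       (auto intro: irred_closed_image simp: image_mono)
qed

lemma top_dim_image: "top_dim C (h ` V) = top_dim C V"
  using top_dim_le_image[of V] top_automorphism.top_dim_le_image[OF sym, of "h ` V"]
  by (simp add: gh_image)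

end

section \<open>Ring automorphisms\<close>

text \<open>The inverse \<open>g\<close> is part of the locale, so that images under \<open>h\<close> are preimages under \<open>g\<close> and
  every statement about \<open>h\<close> can be applied to \<open>g\<close>.\<close>

locale ring_automorphism = h: comm_ring_hom h + g: comm_ring_hom g
  for h g :: "'a::comm_ring_1 \<Rightarrow> 'a" +
  assumes gh: "g (h x) = x" and hg: "h (g x) = x"
begin

lemma sym: "ring_automorphism g h"
  by unfold_locales (auto simp: gh hg)

lemma gh_image: "g ` h ` Z = Z" and hg_image: "h ` g ` Z = Z"
  by (auto simp: image_image gh hg)

lemma mem_image_iff: "x \<in> h ` Z \<longleftrightarrow> g x \<in> Z"
  by (metis gh hg image_iff)

lemma inj_image: "inj ((`) h)"
  by (metis gh_image injI)

lemma subspace_image: "idl.subspace I \<Longrightarrow> idl.subspace (h ` I)"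
  unfolding idl.subspace_def by (auto simp: mem_image_iff g.hom_add g.hom_mult gh)

lemma span_image: "h ` idl.span S = idl.span (h ` S)"
proof -
  interpret s: ring_automorphism g h by (rule sym)
  have le: "idl.span (h ` S) \<subseteq> h ` idl.span S" for S
    by (intro idl.span_minimal subspace_image image_mono idl.span_superset idl.subspace_span)
  have "idl.span (g ` T) \<subseteq> g ` idl.span T" for T
    by (intro idl.span_minimal s.subspace_image image_mono idl.span_superset idl.subspace_span)
  from this[of "h ` S"] have "h ` idl.span S \<subseteq> idl.span (h ` S)"
    unfolding gh_image by (metis hg_image image_mono)
  with le show ?thesis by blast
qed

lemma prime_image: "prime_idl P \<Longrightarrow> prime_idl (h ` P)"
  unfolding prime_idl_def
proof (elim conjE, intro conjI)
  assume "P \<noteq> UNIV"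
  then obtain x where "x \<notin> P" by blast
  then have "h x \<notin> h ` P" by (simp add: mem_image_iff gh)
  then show "h ` P \<noteq> UNIV" by blast
qed (auto simp: subspace_image mem_image_iff g.hom_mult gh)

lemma primary_image: "primary_idl P \<Longrightarrow> primary_idl (h ` P)"
  unfolding primary_idl_def
  by (elim conjE, intro conjI) (simp_all only: subspace_image mem_image_iff g.hom_mult g.hom_power, blast)

lemma rad_image: "rad (h ` I) = h ` rad I"
  by (auto simp: rad_def mem_image_iff g.hom_power gh)

lemma idl_dim_le_image: "idl_dim I \<le> idl_dim (h ` I)"
  unfolding idl_dim_def
proof (rule Sup_subset_mono, rule Collect_mono, safe)
  fix m and P :: "nat \<Rightarrow> 'a set"
  assume P: "\<forall>i\<le>m. prime_idl (P i) \<and> I \<subseteq> P i" "\<forall>i<m. P i \<subset> P (Suc i)"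
  have "h ` A \<subset> h ` A'" if "A \<subset> A'" for A A'
    using that by (metis gh_image image_mono psubset_eq)
  with P show "\<exists>m'. enat m = enat m' \<and> (\<exists>P. (\<forall>i\<le>m'. prime_idl (P i) \<and> h ` I \<subseteq> P i) \<and>
      (\<forall>i<m'. P i \<subset> P (Suc i)))"
    by (intro exI[of _ m] conjI refl exI[of _ "\<lambda>i. h ` P i"])
       (auto intro: prime_image simp: image_mono)
qed

lemma idl_dim_image: "idl_dim (h ` I) = idl_dim I"
  using idl_dim_le_image[of I] ring_automorphism.idl_dim_le_image[OF sym, of "h ` I"]
  by (simp add: gh_image)

lemma Inter_image: "\<Inter>((`) h ` Qs) = h ` \<Inter>Qs"
  by (rule Set.set_eqI) (simp add: mem_image_iff)

lemma min_primary_decomp_image: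
  assumes "min_primary_decomp I Qs"
  shows "min_primary_decomp (h ` I) ((`) h ` Qs)"
proof -
  from assms have Qs: "finite Qs" "\<And>Q. Q \<in> Qs \<Longrightarrow> primary_idl Q" "\<Inter>Qs = I" "inj_on rad Qs"
    and irr: "\<And>Q. Q \<in> Qs \<Longrightarrow> \<Inter>(Qs - {Q}) \<noteq> I"
    unfolding min_primary_decomp_def by blast+
  have inj: "h ` A = h ` A' \<longleftrightarrow> A = A'" for A A'
    by (rule inj_eq[OF inj_image])
  have "(`) h ` Qs - {h ` Q} = (`) h ` (Qs - {Q})" for Q
    using image_set_diff[OF inj_image, of Qs "{Q}"] by simp
  then have "\<Inter>((`) h ` Qs - {h ` Q}) \<noteq> h ` I" if "Q \<in> Qs" for Q
    using irr[OF that] by (simp only: Inter_image inj not_False_eq_True)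
  moreover have "inj_on rad ((`) h ` Qs)"
  proof (rule inj_onI, elim imageE)
    fix Y Y' Q Q' assume "rad Y = rad Y'" "Y = h ` Q" "Y' = h ` Q'" "Q \<in> Qs" "Q' \<in> Qs"
    then show "Y = Y'"
      using Qs(4) by (simp add: rad_image inj inj_on_eq_iff)
  qed
  ultimately show ?thesis
    using Qs unfolding min_primary_decomp_def Inter_image ball_simps
    by (intro conjI) (simp_all add: primary_image)
qed

end

section \<open>Invariance under invertible linear substitutions\<close>

context
  fixes M N :: "'k::field ^ 'e::finite ^ 'e"
  assumes MN: "M ** N = id_mat"
begin

lemma right_inverse_imp_left_inverse: "N ** M = id_mat"
  using MN matrix_left_right_inverse by blast

lemma lsub_inverse: "lsub N (lsub M f) = f" "lsub M (lsub N f) = f"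
  by (simp_all add: lsub_lsub MN right_inverse_imp_left_inverse lsub_1)

lemma vec_inverse: "N *v (M *v x) = x" "M *v (N *v x) = x"
  by (simp_all add: matrix_vector_mul_assoc MN right_inverse_imp_left_inverse)

lemma ring_automorphism_lsub: "ring_automorphism (lsub M) (lsub N)"
proof -
  interpret m: comm_ring_hom "lsub M" by (rule lsub_hom)
  interpret n: comm_ring_hom "lsub N" by (rule lsub_hom)
  show ?thesis by unfold_locales (simp_all add: lsub_inverse)
qed

text \<open>The dimension is transported with a basis, since the space of all polynomials is
  infinite-dimensional.\<close>

lemma dim_lsub_image: "mp.dim (lsub M ` A) = mp.dim A"
proof -
  interpret vector_space_pair "pscale :: 'k \<Rightarrow> ('e, 'k) mpoly \<Rightarrow> _" "pscale :: 'k \<Rightarrow> ('e, 'k) mpoly \<Rightarrow> _" ..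
  obtain S where S: "S \<subseteq> A" "mp.independent S" "A \<subseteq> mp.span S" "card S = mp.dim A"
    by (rule mp.basis_exists)
  have inj: "inj_on (lsub M) Z" for Z
    by (metis inj_on_def lsub_inverse(1))
  show ?thesis
  proof (rule mp.dim_unique)
    show "lsub M ` S \<subseteq> lsub M ` A" using S(1) by blast
    show "lsub M ` A \<subseteq> mp.span (lsub M ` S)"
      using S(3) linear_span_image[OF lsub_linear, of M S] by blast
    show "mp.independent (lsub M ` S)"
      using linear_independent_injective_image[OF lsub_linear S(2) inj] .
    show "card (lsub M ` S) = mp.dim A" using S(4) inj card_image by metis
  qed
qed

lemma mdeg_keys_lsub_iff:
  "(\<forall>m\<in>Poly_Mapping.keys (lsub M f). P (mdeg m)) \<longleftrightarrow> (\<forall>m\<in>Poly_Mapping.keys f. P (mdeg m))"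
  using keys_lsub[of _ M f] keys_lsub[of _ N "lsub M f"] unfolding lsub_inverse by metis

lemma hom_poly_lsub_iff: "hom_poly s (lsub M f) \<longleftrightarrow> hom_poly s f"
  unfolding hom_poly_def by (rule mdeg_keys_lsub_iff)

lemma graded_part_image:
  "{f \<in> lsub M ` I. \<forall>m\<in>Poly_Mapping.keys f. P (mdeg m)} =
    lsub M ` {f \<in> I. \<forall>m\<in>Poly_Mapping.keys f. P (mdeg m)}"
  using mdeg_keys_lsub_iff[of _ P] by blast

lemma hilbert_fun_image: "hilbert_fun (lsub M ` I) = hilbert_fun I"
proof
  fix s
  have "mp.dim {f \<in> lsub M ` I. hom_poly s f} = mp.dim {f \<in> I. hom_poly s f}"
    unfolding hom_poly_def graded_part_image[of _ "\<lambda>d. d = s"] by (rule dim_lsub_image)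
  then show "hilbert_fun (lsub M ` I) s = hilbert_fun I s" by (simp add: hilbert_fun_def)
qed

lemma aff_hilbert_fun_image: "aff_hilbert_fun (lsub M ` I) = aff_hilbert_fun I"
proof
  fix s
  show "aff_hilbert_fun (lsub M ` I) s = aff_hilbert_fun I s"
    unfolding aff_hilbert_fun_def graded_part_image[of _ "\<lambda>d. d \<le> s"] dim_lsub_image ..
qed

lemma homogeneous_image:
  assumes "homogeneous_idl I"
  shows "homogeneous_idl (lsub M ` I)"
proof -
  interpret ring_automorphism "lsub M" "lsub N" by (rule ring_automorphism_lsub)
  have "{f \<in> lsub M ` I. \<exists>s. hom_poly s f} = lsub M ` {f \<in> I. \<exists>s. hom_poly s f}"
    using hom_poly_lsub_iff by blast
  then show ?thesis
    using assms unfolding homogeneous_idl_def by (simp add: subspace_image flip: span_image)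
qed

text \<open>Since \<open>(lsub M f)(x) = f(M x)\<close>, a point \<open>x\<close> is a zero of the substituted polynomials iff \<open>M x\<close>
  is a zero of the original ones; so zero sets move by the inverse \<open>N\<close>.\<close>

lemma zeros_image: "zeros (lsub M ` S) = (*v) N ` zeros S"
proof -
  have "x \<in> zeros (lsub M ` S) \<longleftrightarrow> M *v x \<in> zeros S" for x
    by (simp add: zeros_def peval_lsub)
  moreover have "x \<in> (*v) N ` Z \<longleftrightarrow> M *v x \<in> Z" for x Z
    by (metis image_iff vec_inverse)
  ultimately show ?thesis by blast
qed

lemma image_span: "(*v) N ` vec.span {x} = vec.span {N *v x}"
  using vec.linear_span_image[OF matrix_vector_mul_linear_gen, of N "{x}"] by simp

lemma proj_zeros_image: "proj_zeros (lsub M ` S) = (`) ((*v) N) ` proj_zeros S"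
proof -
  have nz: "N *v x \<noteq> 0 \<longleftrightarrow> x \<noteq> 0" for x
    by (metis matrix_vector_mult_0_right vec_inverse(2))
  have "proj_zeros (lsub M ` S) = {vec.span {N *v x} | x. x \<noteq> 0 \<and> x \<in> zeros S}"
    unfolding proj_zeros_def zeros_image using nz by blast
  then show ?thesis
    by (simp only: proj_zeros_def setcompr_eq_image image_image image_span)
qed

lemma vanishing_idl_image: "vanishing_idl ((*v) N ` V) = lsub M ` vanishing_idl V"
proof -
  have "f \<in> vanishing_idl ((*v) N ` V) \<longleftrightarrow> lsub N f \<in> vanishing_idl V" for f
    by (simp add: vanishing_idl_def peval_lsub)
  moreover have "f \<in> lsub M ` I \<longleftrightarrow> lsub N f \<in> I" for f I
    by (metis image_iff lsub_inverse)
  ultimately show ?thesis by blast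
qed

lemma aff_closed_image: "Z \<in> aff_closed UNIV \<Longrightarrow> (*v) N ` Z \<in> aff_closed UNIV"
proof -
  assume "Z \<in> aff_closed UNIV"
  then obtain S where "Z = zeros S" unfolding aff_closed_def by blast
  then have "(*v) N ` Z = zeros (lsub M ` S)" by (simp add: zeros_image)
  then show ?thesis unfolding aff_closed_def by blast
qed

lemma proj_closed_image: "Z \<in> proj_closed \<Longrightarrow> (`) ((*v) N) ` Z \<in> proj_closed"
proof -
  assume "Z \<in> proj_closed"
  then obtain S where S: "Z = proj_zeros S" "\<forall>f\<in>S. \<exists>s. hom_poly s f"
    unfolding proj_closed_def by blast
  have "\<forall>f\<in>lsub M ` S. \<exists>s. hom_poly s f"
    using S(2) by (simp add: hom_poly_lsub_iff)
  then have "proj_zeros (lsub M ` S) \<in> proj_closed" unfolding proj_closed_def by blast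
  then show ?thesis by (simp only: S(1) proj_zeros_image)
qed

end

lemma top_automorphism_aff:
  fixes M N :: "'l::field ^ 'e::finite ^ 'e"
  assumes MN: "M ** N = id_mat"
  shows "top_automorphism (aff_closed UNIV) ((*v) N) ((*v) M)"
  by unfold_locales
    (simp_all add: vec_inverse[OF MN] aff_closed_image[OF MN]
      aff_closed_image[OF right_inverse_imp_left_inverse[OF MN]])

lemma top_automorphism_proj:
  fixes M N :: "'l::field ^ 'e::finite ^ 'e"
  assumes MN: "M ** N = id_mat"
  shows "top_automorphism proj_closed ((`) ((*v) N)) ((`) ((*v) M))"
  by unfold_locales
    (simp_all add: image_image vec_inverse[OF MN] proj_closed_image[OF MN]
      proj_closed_image[OF right_inverse_imp_left_inverse[OF MN]])

lemma var_degree_image: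
  fixes M N :: "'l::field ^ 'e::finite ^ 'e"
  assumes MN: "M ** N = id_mat"
  shows "var_degree ((*v) N ` V) = var_degree V"
  unfolding var_degree_def vanishing_idl_image[OF MN] aff_hilbert_fun_image[OF MN]
    top_automorphism.top_dim_image[OF top_automorphism_aff[OF MN]] ..

text \<open>Closed sets defined over the small field are the zero sets of extended polynomials over that
  field. In this form it is clear that a substitution with a matrix over the small field, extended
  to the algebraic closure, preserves them.\<close>

lemma aff_closed_range_to_ac: "aff_closed (range to_ac) = {zeros (map_ac ` S) | S. True}"
proof (intro Set.set_eqI iffI)
  fix Z :: "('a alg_closure ^ 'b) set" assume "Z \<in> aff_closed (range to_ac)"
  then obtain S where Z: "Z = zeros S" and S: "\<forall>f\<in>S. \<forall>m. Poly_Mapping.lookup f m \<in> range to_ac"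
    unfolding aff_closed_def by blast
  have "f = map_ac (Poly_Mapping.map of_ac f)" if "f \<in> S" for f
  proof (rule poly_mapping_eqI)
    fix m
    have "Poly_Mapping.lookup f m \<in> range to_ac" using S that by simp
    then obtain c where c: "Poly_Mapping.lookup f m = to_ac c" by (rule rangeE)
    have "Poly_Mapping.lookup (Poly_Mapping.map of_ac f) m = c"
      using c by (cases "c = 0") (simp_all add: Poly_Mapping.map.rep_eq)
    then show "Poly_Mapping.lookup f m = Poly_Mapping.lookup (map_ac (Poly_Mapping.map of_ac f)) m"
      by (simp only: lookup_map_ac c)
  qed
  then have "S = map_ac ` (Poly_Mapping.map of_ac ` S)"
    unfolding image_image by (metis (no_types, lifting) image_cong image_ident)
  then have "Z = zeros (map_ac ` (Poly_Mapping.map of_ac ` S))"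
    by (rule subst[where P = "\<lambda>A. Z = zeros A"]) (rule Z)
  then show "Z \<in> {zeros (map_ac ` S) | S. True}" by blast
next
  fix Z :: "('a alg_closure ^ 'b) set" assume "Z \<in> {zeros (map_ac ` S) | S. True}"
  then obtain S :: "('b, 'a) mpoly set" where "Z = zeros (map_ac ` S)" by blast
  moreover have "\<forall>f\<in>map_ac ` S. \<forall>m. Poly_Mapping.lookup f m \<in> range to_ac"
    by (simp add: lookup_map_ac)
  ultimately show "Z \<in> aff_closed (range to_ac)" unfolding aff_closed_def by blast
qed

lemma map_ac_lsub_image: "map_ac ` lsub M ` S = lsub (mat_ac M) ` map_ac ` S"
  by (simp add: image_image map_ac_lsub)

context
  fixes M N :: "'k::field ^ 'e::finite ^ 'e"
  assumes MN: "M ** N = id_mat"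
begin

lemma mat_ac_inverse: "mat_ac M ** mat_ac N = id_mat"
  by (simp add: mat_ac_mult[symmetric] MN mat_ac_1)

lemma aff_closed_to_ac_image:
  assumes "Z \<in> aff_closed (range (to_ac :: 'k \<Rightarrow> _))"
  shows "(*v) (mat_ac N) ` Z \<in> aff_closed (range (to_ac :: 'k \<Rightarrow> _))"
proof -
  obtain S :: "('e, 'k) mpoly set" where "Z = zeros (map_ac ` S)"
    using assms unfolding aff_closed_range_to_ac by blast
  then have "(*v) (mat_ac N) ` Z = zeros (map_ac ` lsub M ` S)"
    by (simp only: map_ac_lsub_image zeros_image[OF mat_ac_inverse])
  then show ?thesis unfolding aff_closed_range_to_ac by blast
qed

end

context
  fixes M N :: "'k::field ^ 'e::finite ^ 'e"
  assumes MN: "M ** N = id_mat"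
begin

lemma top_automorphism_aff_to_ac:
  "top_automorphism (aff_closed (range (to_ac :: 'k \<Rightarrow> _))) ((*v) (mat_ac N)) ((*v) (mat_ac M))"
  by unfold_locales
    (simp_all only: vec_inverse[OF mat_ac_inverse[OF MN]] aff_closed_to_ac_image[OF MN]
      aff_closed_to_ac_image[OF right_inverse_imp_left_inverse[OF MN]])

lemma Vaff_image: "Vaff (lsub M ` I) = (*v) (mat_ac N) ` Vaff I"
  by (simp only: Vaff_def map_ac_lsub_image zeros_image[OF mat_ac_inverse[OF MN]])

lemma Vproj_image: "Vproj (lsub M ` I) = (`) ((*v) (mat_ac N)) ` Vproj I"
  by (simp only: Vproj_def map_ac_lsub_image proj_zeros_image[OF mat_ac_inverse[OF MN]])

lemma Vaff_rat_image: "Vaff_rat (lsub M ` I) = (*v) N ` Vaff_rat I"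
  by (simp only: Vaff_rat_def zeros_image[OF MN])

lemma idl_degree_lsub: "idl_degree (lsub M ` I) = idl_degree I"
  unfolding idl_degree_def Vproj_image hilbert_fun_image[OF MN]
    top_automorphism.top_dim_image[OF top_automorphism_proj[OF mat_ac_inverse[OF MN]]]
  by simp

lemma idl_dim_lsub: "idl_dim (lsub M ` I) = idl_dim I"
  by (rule ring_automorphism.idl_dim_image[OF ring_automorphism_lsub[OF MN]])

lemma var_degree_Vaff_lsub: "var_degree (Vaff (lsub M ` I)) = var_degree (Vaff I)"
  unfolding Vaff_image by (rule var_degree_image[OF mat_ac_inverse[OF MN]])

lemma card_components_lsub: "card (var_components (lsub M ` I)) = card (var_components I)"
  unfolding var_components_def Vaff_image
  by (rule top_automorphism.card_components_image[OF top_automorphism_aff_to_ac])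

lemma card_geom_components_lsub: "card (var_geom_components (lsub M ` I)) = card (var_geom_components I)"
  unfolding var_geom_components_def Vaff_image
  by (rule top_automorphism.card_components_image[OF top_automorphism_aff[OF mat_ac_inverse[OF MN]]])

lemma inj_on_matrix: "inj_on ((*v) N) Z"
  by (metis inj_on_def vec_inverse(2)[OF MN])

lemma card_Vaff_rat_lsub: "card (Vaff_rat (lsub M ` I)) = card (Vaff_rat I)"
  unfolding Vaff_rat_image by (rule card_image[OF inj_on_matrix])

lemma dim_span_Vaff_rat_lsub:
  "vec.dim (vec.span (Vaff_rat (lsub M ` I))) = vec.dim (vec.span (Vaff_rat I))"
  unfolding Vaff_rat_image vec.dim_span
  by (rule vec.dim_image_eq[OF matrix_vector_mul_linear_gen inj_on_matrix])

text \<open>A substitution carries a minimal homogeneous primary decomposition of \<open>I\<close> to one of the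
  image, with the same degrees and dimensions. The reverse inclusion comes from the inverse
  substitution.\<close>

lemma primary_data_subset: "primary_data I \<subseteq> primary_data (lsub M ` I)"
proof
  interpret ring_automorphism "lsub M" "lsub N" by (rule ring_automorphism_lsub[OF MN])
  fix D assume "D \<in> primary_data I"
  then obtain Qs where D: "D = image_mset (\<lambda>Q. (idl_degree Q, idl_dim Q)) (mset_set Qs)"
    and Qs: "min_primary_decomp I Qs" "\<forall>Q\<in>Qs. homogeneous_idl Q"
    unfolding primary_data_def by blast
  let ?Qs = "(`) (lsub M) ` Qs"
  have "mset_set ?Qs = image_mset ((`) (lsub M)) (mset_set Qs)"
    using image_mset_mset_set[OF inj_on_subset[OF inj_image subset_UNIV], of Qs] by simp
  then have "D = image_mset (\<lambda>Q. (idl_degree Q, idl_dim Q)) (mset_set ?Qs)"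
    by (simp add: D image_mset.compositionality comp_def idl_degree_lsub idl_dim_lsub)
  moreover have "min_primary_decomp (lsub M ` I) ?Qs" by (rule min_primary_decomp_image[OF Qs(1)])
  moreover have "\<forall>Q\<in>?Qs. homogeneous_idl Q" using Qs(2) homogeneous_image[OF MN] by simp
  ultimately show "D \<in> primary_data (lsub M ` I)" unfolding primary_data_def by blast
qed

end

lemma primary_data_lsub:
  fixes M N :: "'k::field ^ 'e::finite ^ 'e"
  assumes MN: "M ** N = id_mat"
  shows "primary_data (lsub M ` I) = primary_data I"
  using primary_data_subset[OF MN, of I] primary_data_subset[OF right_inverse_imp_left_inverse[OF MN], of "lsub M ` I"]
  by (simp add: image_image lsub_inverse[OF MN])

lemmas lsub_invariants =
  idl_degree_lsub idl_dim_lsub primary_data_lsub var_degree_Vaff_lsub card_Vaff_rat_lsub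
  card_components_lsub card_geom_components_lsub dim_span_Vaff_rat_lsub

section \<open>Determinantal ideals of products\<close>

lemma det_idl_minor: "inj_on r {..<k} \<Longrightarrow> inj_on c {..<k} \<Longrightarrow>
   det (Matrix.mat k k (\<lambda>(i, j). D $ r i $ c j)) \<in> det_idl D k"
  unfolding det_idl_def minors_def by (rule idl.span_base) blast

text \<open>Each row of \<open>P ** D\<close> is a linear combination of rows of \<open>D\<close>. Expanding a minor in its rows
  gives a combination of determinants formed from rows \<open>f 0, \<dots>, f (k - 1)\<close> of \<open>D\<close>; those in which
  a row is repeated vanish, and the others are minors of \<open>D\<close>.\<close>

lemma det_idl_mult_left_subset: "det_idl (P ** D) k \<subseteq> det_idl D k"
  for D :: "'a::comm_ring_1 ^ 'n ^ 'm"
  unfolding det_idl_def[of "P ** D"]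
proof (rule idl.span_minimal)
  show "idl.subspace (det_idl D k)" by (simp add: det_idl_def)
  show "minors k (P ** D) \<subseteq> det_idl D k"
  proof
    fix x assume "x \<in> minors k (P ** D)"
    then obtain r c where c: "inj_on c {..<k}"
      and x: "x = det (Matrix.mat k k (\<lambda>(i, j). (P ** D) $ r i $ c j))"
      by (auto simp: minors_def)
    let ?F = "{0..<k} \<rightarrow>\<^sub>E (UNIV :: 'm set)"
    let ?S = "{p. p permutes {0..<k}}"
    have entry: "Matrix.mat k k (\<lambda>(i, j). (P ** D) $ r i $ c j) $$ (i, p i)
        = (\<Sum>a\<in>UNIV. P $ r i $ a * D $ a $ c (p i))" if "p \<in> ?S" "i \<in> {0..<k}" for p i
      using that permutes_in_image[of p "{0..<k}" i] by (simp add: matrix_matrix_mult_def)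
    have entry': "Matrix.mat k k (\<lambda>(i, j). D $ f i $ c j) $$ (i, p i) = D $ f i $ c (p i)"
      if "p \<in> ?S" "i \<in> {0..<k}" for p i and f :: "nat \<Rightarrow> 'm"
      using that permutes_in_image[of p "{0..<k}" i] by simp
    have "x = (\<Sum>p\<in>?S. signof p * (\<Prod>i = 0..<k. \<Sum>a\<in>UNIV. P $ r i $ a * D $ a $ c (p i)))"
      unfolding x det_def'[OF mat_carrier]
      by (intro sum.cong refl arg_cong2[where f = "(*)"] prod.cong) (rule entry)
    also have "\<dots> = (\<Sum>p\<in>?S. \<Sum>f\<in>?F.
        signof p * ((\<Prod>i = 0..<k. P $ r i $ f i) * (\<Prod>i = 0..<k. D $ f i $ c (p i))))"
      by (simp only: prod_sum_PiE[OF finite_atLeastLessThan finite_class.finite_UNIV] sum_distrib_left prod.distrib)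
    also have "\<dots> = (\<Sum>f\<in>?F. (\<Prod>i = 0..<k. P $ r i $ f i) *
        (\<Sum>p\<in>?S. signof p * (\<Prod>i = 0..<k. D $ f i $ c (p i))))"
      by (subst sum.swap) (simp only: sum_distrib_left mult.left_commute)
    also have "\<dots> = (\<Sum>f\<in>?F. (\<Prod>i = 0..<k. P $ r i $ f i) *
        det (Matrix.mat k k (\<lambda>(i, j). D $ f i $ c j)))"
      unfolding det_def'[OF mat_carrier]
      by (intro sum.cong refl arg_cong2[where f = "(*)"] prod.cong) (rule entry'[symmetric])
    also have "\<dots> \<in> det_idl D k"
      unfolding det_idl_def
    proof (intro idl.span_sum idl.span_scale)
      fix f :: "nat \<Rightarrow> 'm"
      show "det (Matrix.mat k k (\<lambda>(i, j). D $ f i $ c j)) \<in> idl.span (minors k D)"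
      proof (cases "inj_on f {..<k}")
        case True
        then show ?thesis using det_idl_minor[OF True c] by (simp add: det_idl_def)
      next
        case False
        then obtain i j where "i < k" "j < k" "i \<noteq> j" "f i = f j" by (auto simp: inj_on_def)
        then have "det (Matrix.mat k k (\<lambda>(i, j). D $ f i $ c j)) = 0"
          by (intro det_identical_rows[of _ k i j]) (auto intro!: eq_vecI)
        then show ?thesis by (simp add: idl.span_zero)
      qed
    qed
    finally show "x \<in> det_idl D k" .
  qed
qed

lemma minors_transpose_subset: "minors k (Finite_Cartesian_Product.transpose D) \<subseteq> minors k D"
proof
  fix x assume "x \<in> minors k (Finite_Cartesian_Product.transpose D)"
  then obtain r c where rc: "inj_on r {..<k}" "inj_on c {..<k}"
    and x: "x = det (Matrix.mat k k (\<lambda>(i, j). Finite_Cartesian_Product.transpose D $ r i $ c j))"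
    unfolding minors_def by blast
  have "Matrix.mat k k (\<lambda>(i, j). Finite_Cartesian_Product.transpose D $ r i $ c j) =
      transpose_mat (Matrix.mat k k (\<lambda>(i, j). D $ c i $ r j))"
    by (rule eq_matI) (auto simp: Finite_Cartesian_Product.transpose_def)
  then have "x = det (Matrix.mat k k (\<lambda>(i, j). D $ c i $ r j))"
    unfolding x by (simp only: det_transpose[OF mat_carrier])
  with rc show "x \<in> minors k D" unfolding minors_def by blast
qed

lemma det_idl_transpose: "det_idl (Finite_Cartesian_Product.transpose D) k = det_idl D k"
proof -
  have "minors k (Finite_Cartesian_Product.transpose D) = minors k D"
    using minors_transpose_subset[of k D]
      minors_transpose_subset[of k "Finite_Cartesian_Product.transpose D"] by simp
  then show ?thesis by (simp add: det_idl_def)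
qed

lemma det_idl_mult_left:
  assumes "P' ** P = id_mat"
  shows "det_idl (P ** D) k = det_idl D k"
  using det_idl_mult_left_subset[of P D k] det_idl_mult_left_subset[of P' "P ** D" k] assms
  by (simp add: matrix_mul_assoc)

lemma det_idl_mult_right:
  assumes "P ** P' = id_mat"
  shows "det_idl (D ** P) k = det_idl D k"
proof -
  have "Finite_Cartesian_Product.transpose P' ** Finite_Cartesian_Product.transpose P = id_mat"
    using assms by (metis matrix_transpose_mul transpose_mat)
  from det_idl_mult_left[OF this, of "Finite_Cartesian_Product.transpose D" k]
  show ?thesis by (simp add: matrix_transpose_mul[symmetric] det_idl_transpose)
qed

definition map_entries :: "('a \<Rightarrow> 'b) \<Rightarrow> 'a ^ 'n ^ 'm \<Rightarrow> 'b ^ 'n ^ 'm" where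
  "map_entries h D = (\<chi> i j. h (D $ i $ j))"

lemma (in ring_automorphism) det_idl_map_entries: "det_idl (map_entries h D) k = h ` det_idl D k"
proof -
  have "h (det (Matrix.mat k k (\<lambda>(i, j). D $ r i $ c j))) =
      det (Matrix.mat k k (\<lambda>(i, j). map_entries h D $ r i $ c j))" for r c
    unfolding h.hom_det[symmetric] by (intro arg_cong[where f = det] eq_matI) (auto simp: map_entries_def)
  then have "minors k (map_entries h D) = h ` minors k D"
    unfolding minors_def by (auto simp: image_iff) metis+
  then show ?thesis by (simp add: det_idl_def span_image)
qed

section \<open>Extending linear maps to invertible ones\<close>

text \<open>Both \<open>S\<close> and its image extend to bases, and the two complements have the same number of
  elements, so that \<open>f\<close> extends to a bijection between bases.\<close>

lemma linear_extend_invertible: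
  fixes f :: "'k::field ^ 'n \<Rightarrow> 'k ^ 'n"
  assumes S: "vec.independent S" and inj: "inj_on f S" and fS: "vec.independent (f ` S)"
  obtains M N where "M ** N = id_mat" "N ** M = id_mat"
    "\<And>v. v \<in> S \<Longrightarrow> M *v v = f v"
proof -
  let ?B = "vec.extend_basis S" and ?C = "vec.extend_basis (f ` S)"
  have B: "S \<subseteq> ?B" "vec.independent ?B" "vec.span ?B = UNIV"
    using S by (auto simp: vec.extend_basis_superset vec.independent_extend_basis)
  have C: "f ` S \<subseteq> ?C" "vec.independent ?C" "vec.span ?C = UNIV"
    using fS by (auto simp: vec.extend_basis_superset vec.independent_extend_basis)
  have fin: "finite ?B" "finite ?C" using B C vec.finiteI_independent by auto
  have "card ?B = card ?C"
    using vec.dim_eq_card[of ?B UNIV] vec.dim_eq_card[of ?C UNIV] B C by simp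
  then have "card (?B - S) = card (?C - f ` S)"
    using B(1) C(1) fin by (simp add: card_Diff_subset finite_subset card_image inj)
  then obtain h where h: "bij_betw h (?B - S) (?C - f ` S)"
    using fin finite_same_card_bij[of "?B - S" "?C - f ` S"] by auto
  define g where "g = vec.construct ?B (\<lambda>v. if v \<in> S then f v else h v)"
  have lin: "Vector_Spaces.linear (*s) (*s) g"
    unfolding g_def using B(2) by (rule vec.linear_construct)
  have g: "g v = (if v \<in> S then f v else h v)" if "v \<in> ?B" for v
    unfolding g_def using B(2) that by (rule vec.construct_basis)
  have "g ` ?B = g ` S \<union> g ` (?B - S)" using B(1) by blast
  also have "g ` S = f ` S" using B(1) g by (intro image_cong) auto
  also have "g ` (?B - S) = h ` (?B - S)" using g by (intro image_cong) auto
  also have "h ` (?B - S) = ?C - f ` S" using h by (simp add: bij_betw_def)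
  finally have "g ` ?B = ?C" using C(1) by blast
  then have "range g = UNIV"
    using vec.linear_span_image[OF lin, of ?B] B(3) C(3) by simp
  then have "surj ((*v) (matrix g))"
    using matrix_works[OF lin] by (metis surj_def)
  then obtain N where N: "matrix g ** N = id_mat"
    using matrix_right_invertible_surjective[of "matrix g"] by auto
  show ?thesis
  proof (rule that[OF N])
    show "N ** matrix g = id_mat"
      using N matrix_left_right_inverse by blast
    show "matrix g *v v = f v" if "v \<in> S" for v
      using that B(1) g matrix_works[OF lin] by auto
  qed
qed

lemma linear_extend_invertible_subspace:
  fixes f :: "'k::field ^ 'n \<Rightarrow> 'k ^ 'n"
  assumes lin: "Vector_Spaces.linear (*s) (*s) f" and inj: "inj_on f (vec.span T)"
  obtains M N where "M ** N = id_mat" "N ** M = id_mat"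
    "\<And>v. v \<in> T \<Longrightarrow> M *v v = f v"
proof -
  obtain S where S: "S \<subseteq> T" "vec.independent S" "T \<subseteq> vec.span S"
    by (rule vec.maximal_independent_subset)
  have inj': "inj_on f (vec.span S)"
    using inj S(1) by (meson inj_on_subset vec.span_mono)
  then have "vec.independent (f ` S)"
    using vec.linear_independent_injective_image[OF lin S(2)] by simp
  moreover have "inj_on f S" using inj' by (meson inj_on_subset vec.span_superset)
  ultimately obtain M N where MN: "M ** N = id_mat" "N ** M = id_mat"
    and M: "\<And>v. v \<in> S \<Longrightarrow> M *v v = f v"
    using linear_extend_invertible[OF S(2)] by blast
  have "M *v v = f v" if "v \<in> T" for v
    using vec.linear_eq_on[OF matrix_vector_mul_linear_gen lin, of v S M] that S(3) M by blast
  with MN that show ?thesis by blast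
qed

text \<open>The hypotheses say that \<open>a\<close> induces an isomorphism from the quotient by \<open>R\<close> onto the quotient
  by \<open>R'\<close>. An invertible lift of it agrees with \<open>a\<close> on a basis \<open>C\<close> of a complement of \<open>R\<close>, and
  sends a basis \<open>S\<close> of \<open>R\<close> to a basis \<open>S'\<close> of \<open>R'\<close>. The point is that \<open>S'\<close> and \<open>a ` C\<close> together
  form a basis of the whole space; then \<open>S\<close> and \<open>S'\<close> have the same size by counting.\<close>

lemma invertible_lift_of_quotient_iso:
  fixes a :: "'k::field ^ 'n \<Rightarrow> 'k ^ 'n"
  assumes lin: "Vector_Spaces.linear (*s) (*s) a"
    and R: "vec.subspace R" and R': "vec.subspace R'"
    and iff: "\<And>v. a v \<in> R' \<longleftrightarrow> v \<in> R"
    and sur: "\<And>u. \<exists>v. u - a v \<in> R'"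
  obtains M N where "M ** N = id_mat" "N ** M = id_mat"
    "\<And>v. M *v v - a v \<in> R'"
proof -
  interpret a: Vector_Spaces.linear "(*s)" "(*s)" a by (rule lin)
  obtain S where S: "S \<subseteq> R" "vec.independent S" "R \<subseteq> vec.span S"
    by (rule vec.maximal_independent_subset)
  obtain S' where S': "S' \<subseteq> R'" "vec.independent S'" "R' \<subseteq> vec.span S'"
    by (rule vec.maximal_independent_subset)
  define C where "C = vec.extend_basis S - S"
  have spanS: "vec.span S = R" using S R by (simp add: subset_antisym vec.span_minimal)
  have spanS': "vec.span S' = R'" using S' R' by (simp add: subset_antisym vec.span_minimal)
  have B: "vec.independent (S \<union> C)" "vec.span (S \<union> C) = UNIV" "S \<inter> C = {}"
    using S(2) vec.extend_basis_superset[of S] vec.independent_extend_basis[of S] vec.span_extend_basis[of S]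
    by (auto simp: C_def Un_absorb1)
  \<comment> \<open>Independence of \<open>C\<close> modulo \<open>R\<close>, carried over to \<open>a ` C\<close> modulo \<open>R'\<close>.\<close>
  have key: "x \<in> C0" if x: "x \<in> C" "C0 \<subseteq> C" and eq: "a x - a y \<in> R'" "y \<in> vec.span C0" for x y C0
  proof (rule ccontr)
    assume "x \<notin> C0"
    have "x - y \<in> vec.span S" using eq(1) iff[of "x - y"] by (simp add: a.diff spanS)
    then have "(x - y) + y \<in> vec.span (S \<union> C0)"
      using eq(2) vec.span_mono[of S "S \<union> C0"] vec.span_mono[of C0 "S \<union> C0"]
      by (intro vec.span_add) auto
    moreover have "S \<union> C0 \<subseteq> (S \<union> C) - {x}"
      using x B(3) \<open>x \<notin> C0\<close> by blast
    ultimately have "x \<in> vec.span ((S \<union> C) - {x})"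
      using vec.span_mono by (metis diff_add_cancel subsetD)
    then show False using B(1) x(1) by (auto simp: vec.dependent_def)
  qed
  have injC: "inj_on a C"
  proof (rule inj_onI)
    fix x y assume "x \<in> C" "y \<in> C" "a x = a y"
    then show "x = y" using key[of x "{y}" y] vec.subspace_0[OF R'] vec.span_base[of y "{y}"] by auto
  qed
  have aC: "a x \<notin> R'" if "x \<in> C" for x
    using key[of x "{}" 0] that by (auto simp: a.zero)
  \<comment> \<open>Any basis between \<open>S'\<close> and \<open>S' \<union> a ` C\<close> already contains all of \<open>a ` C\<close>.\<close>
  obtain B' where B': "S' \<subseteq> B'" "B' \<subseteq> S' \<union> a ` C" "vec.independent B'" "S' \<union> a ` C \<subseteq> vec.span B'"
    using vec.maximal_independent_subset_extend[of S' "S' \<union> a ` C"] S'(2) by blast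
  define C0 where "C0 = {x \<in> C. a x \<in> B'}"
  have B'_eq: "B' = S' \<union> a ` C0" using B'(1,2) by (auto simp: C0_def)
  have "C \<subseteq> C0"
  proof
    fix x assume x: "x \<in> C"
    then have "a x \<in> vec.span (S' \<union> a ` C0)" using B'(4) B'_eq by blast
    then obtain r w where "a x = r + w" "r \<in> R'" "w \<in> a ` vec.span C0"
      unfolding vec.span_Un spanS' a.span_image by blast
    then obtain y where y: "w = a y" "y \<in> vec.span C0" by blast
    have "a x - a y \<in> R'" using \<open>a x = r + w\<close> \<open>r \<in> R'\<close> y(1) by simp
    with y(2) show "x \<in> C0" using key[OF x, of C0] by (auto simp: C0_def)
  qed
  moreover have "C0 \<subseteq> C" by (auto simp: C0_def)
  ultimately have B'_eq: "B' = S' \<union> a ` C" using B'_eq by (metis subset_antisym)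
  have disj: "S' \<inter> a ` C = {}" using S'(1) aC by blast
  have "u \<in> vec.span B'" for u
  proof -
    obtain v where v: "u - a v \<in> R'" using sur by blast
    have "v \<in> vec.span (S \<union> C)" using B(2) by simp
    then obtain r w where vrw: "v = r + w" "r \<in> R" "w \<in> vec.span C"
      unfolding vec.span_Un spanS by blast
    have "(u - a v) + a r \<in> R'" using v iff[of r] vrw(2) R' vec.subspace_add by blast
    then have "(u - a v) + a r \<in> vec.span B'" using spanS' B'(1) vec.span_mono by blast
    moreover have "a w \<in> vec.span B'"
      using vrw(3) a.span_image[of C] vec.span_mono[of "a ` C" B'] B'_eq by blast
    ultimately have "((u - a v) + a r) + a w \<in> vec.span B'" by (rule vec.span_add)
    then show ?thesis by (simp add: vrw(1) a.add)
  qed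
  then have "vec.span B' = UNIV" by blast
  then have "card B' = card (S \<union> C)"
    using vec.dim_eq_card[of B' UNIV] vec.dim_eq_card[of "S \<union> C" UNIV] B B'(3) by simp
  moreover have fin: "finite (S \<union> C)" "finite B'"
    using B(1) B'(3) vec.finiteI_independent by auto
  ultimately have "card S = card S'"
    using B(3) disj injC by (simp add: B'_eq card_Un_disjoint card_image)
  then obtain h where h: "bij_betw h S S'"
    using fin B'(1) finite_same_card_bij[of S S'] finite_subset by blast
  define f where "f x = (if x \<in> S then h x else a x)" for x
  have fS: "f ` S = S'" using h by (auto simp: f_def bij_betw_def)
  have fC: "f ` C = a ` C" using B(3) by (auto simp: f_def)
  have "inj_on f S" using h by (auto simp: f_def bij_betw_def inj_on_def)
  moreover have "inj_on f C" using injC B(3) by (auto simp: f_def inj_on_def)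
  ultimately have "inj_on f (S \<union> C)"
    using fS fC disj by (auto simp: inj_on_Un)
  moreover have "vec.independent (f ` (S \<union> C))"
    using B'(3) by (simp add: image_Un fS fC B'_eq)
  ultimately obtain M N where MN: "M ** N = id_mat" "N ** M = id_mat"
    and M: "\<And>v. v \<in> S \<union> C \<Longrightarrow> M *v v = f v"
    using linear_extend_invertible[OF B(1)] by blast
  have sub: "vec.subspace {v. M *v v - a v \<in> R'}"
  proof (rule vec.subspaceI)
    fix x y c assume "x \<in> {v. M *v v - a v \<in> R'}" "y \<in> {v. M *v v - a v \<in> R'}"
    then have "(M *v x - a x) + (M *v y - a y) \<in> R'" "c *s (M *v x - a x) \<in> R'"
      using R' vec.subspace_add vec.subspace_scale by blast+
    then show "x + y \<in> {v. M *v v - a v \<in> R'}" "c *s x \<in> {v. M *v v - a v \<in> R'}"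
      by (simp_all add: a.add a.scale matrix_vector_right_distrib vec.add vec.scale algebra_simps
        vec.scale_right_diff_distrib)
  qed (use vec.subspace_0[OF R'] a.zero in simp)
  have "S \<union> C \<subseteq> {v. M *v v - a v \<in> R'}"
  proof safe
    fix x assume "x \<in> S"
    then have "h x \<in> R'" "a x \<in> R'" using fS S'(1) S(1) iff by (auto simp: f_def)
    then show "M *v x - a x \<in> R'" using M[of x] \<open>x \<in> S\<close> R' by (simp add: f_def vec.subspace_diff)
  next
    fix x assume "x \<in> C"
    then show "M *v x - a x \<in> R'" using M[of x] B(3) vec.subspace_0[OF R'] by (auto simp: f_def)
  qed
  then have "vec.span (S \<union> C) \<subseteq> {v. M *v v - a v \<in> R'}"
    using sub by (rule vec.span_minimal)
  then have "M *v v - a v \<in> R'" for v using B(2) by blast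
  with MN that show ?thesis by blast
qed

text \<open>A field with \<open>p\<close> elements is the prime field of characteristic \<open>p\<close>, so that scalar
  multiplication is repeated addition.\<close>

lemma prime_card_field_eq_of_nat:
  assumes "prime p" "CARD('k::field) = p"
  shows "CHAR('k) = p" and "\<exists>j. (x::'k) = of_nat j"
proof -
  have fin: "finite (UNIV :: 'k set)" using assms prime_gt_0_nat card_ge_0_finite by metis
  have "CHAR('k) dvd p" using CHAR_dvd_CARD[where ?'a = 'k] assms(2) by simp
  moreover have "CHAR('k) \<noteq> 1" by (simp add: One_nat_def)
  ultimately show char: "CHAR('k) = p" using assms(1) prime_nat_iff by metis
  have "inj_on (of_nat :: nat \<Rightarrow> 'k) {..<p}"
    by (rule inj_onI) (simp add: of_nat_eq_iff_cong_CHAR char cong_def)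
  then have "card ((of_nat :: nat \<Rightarrow> 'k) ` {..<p}) = CARD('k)"
    by (simp add: card_image assms(2))
  then have "(of_nat :: nat \<Rightarrow> 'k) ` {..<p} = UNIV"
    using fin card_subset_eq[of UNIV] by blast
  then show "\<exists>j. (x::'k) = of_nat j" by (metis UNIV_I imageE)
qed

lemma additive_imp_linear:
  fixes f :: "'k::field ^ 'n \<Rightarrow> 'k ^ 'm"
  assumes p: "prime p" "CARD('k) = p" and add: "\<And>x y. f (x + y) = f x + f y"
  shows "Vector_Spaces.linear (*s) (*s) f"
proof -
  have zero: "f 0 = 0" using add[of 0 0] by simp
  have "f (of_nat j *s x) = of_nat j *s f x" for j x
    by (induction j) (simp_all add: zero vec.scale_left_distrib add)
  then have "f (c *s x) = c *s f x" for c x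
    using prime_card_field_eq_of_nat(2)[OF p, of c] by metis
  with add show ?thesis by unfold_locales (simp_all add: vec.scale_right_distrib vec.scale_left_distrib)
qed

section \<open>From group isomorphisms to isometries\<close>

lemma tmap_axis: "tmap B (axis a 1) (axis b 1) $ i = peval (B $ a $ b) (axis i 1)"
proof -
  have "axis a 1 $ a' * peval (B $ a' $ b') e * axis b 1 $ b' =
      (if b' = b then if a' = a then peval (B $ a $ b) e else 0 else 0)" for a' b' e
    by (auto simp: axis_def)
  then show ?thesis unfolding tmap_def vec_lambda_beta by simp
qed

lemma tmap_add_left: "tmap B (u + v) w = tmap B u w + tmap B v w"
  by (simp only: tmap_def Finite_Cartesian_Product.vec_eq_iff vec_lambda_beta vector_add_component
      distrib_right sum.distrib) simp

lemma tmap_add_right: "tmap B w (u + v) = tmap B w u + tmap B w v"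
  by (simp only: tmap_def Finite_Cartesian_Product.vec_eq_iff vec_lambda_beta vector_add_component
      distrib_left sum.distrib) simp

lemma tmap_scale_left: "tmap B (c *s u) w = c *s tmap B u w"
  by (simp only: tmap_def Finite_Cartesian_Product.vec_eq_iff vec_lambda_beta vector_smult_component
      sum_distrib_left mult.assoc) simp

lemma tmap_skew:
  assumes "Finite_Cartesian_Product.transpose B = - B"
  shows "tmap B v u = - tmap B u v"
proof -
  have "B $ b $ a = - (B $ a $ b)" for a b
    using arg_cong[OF assms, of "\<lambda>M. M $ a $ b"] by (simp add: Finite_Cartesian_Product.transpose_def)
  then have skew: "peval (B $ b $ a) x = - peval (B $ a $ b) x" for a b x
  proof -
    interpret comm_ring_hom "\<lambda>f. peval f x" by (rule peval_hom)
    show ?thesis using \<open>\<And>b a. B $ b $ a = - (B $ a $ b)\<close>[of b a] hom_uminus by metis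
  qed
  have "tmap B v u $ i = - tmap B u v $ i" for i
  proof -
    have "tmap B v u $ i = (\<Sum>b\<in>UNIV. \<Sum>a\<in>UNIV. v $ a * peval (B $ a $ b) (axis i 1) * u $ b)"
      unfolding tmap_def vec_lambda_beta by (rule sum.swap)
    also have "\<dots> = (\<Sum>b\<in>UNIV. \<Sum>a\<in>UNIV. - (u $ b * peval (B $ b $ a) (axis i 1) * v $ a))"
      by (intro sum.cong refl) (subst skew, simp)
    also have "\<dots> = - tmap B u v $ i"
      unfolding tmap_def vec_lambda_beta sum_negf ..
    finally show ?thesis .
  qed
  then show ?thesis by (simp add: Finite_Cartesian_Product.vec_eq_iff)
qed

text \<open>The proof compares \<open>\<phi>(g h)\<close> with \<open>\<phi>(h g)\<close>. The elements \<open>g h\<close> and \<open>h g\<close> differ by the central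
  element \<open>(0, t(v, v'))\<close>; hence \<open>\<alpha>\<close> vanishes on commutators, and the second components give the
  relation between \<open>t\<close> and \<open>t'\<close>. Surjectivity of \<open>\<phi>\<close> makes the images of central elements
  central, and this is what makes \<open>\<psi>\<close> additive.\<close>

lemma group_iso_imp_isometry:
  fixes B B' :: "('d::finite, 'k::field) mpoly ^ 'n::finite ^ 'n"
  assumes p: "prime p" "CARD('k) = p" "odd p"
    and skew: "Finite_Cartesian_Product.transpose B = - B" "Finite_Cartesian_Product.transpose B' = - B'"
    and iso: "G_group B \<cong> G_group B'"
  obtains P P' Q Q' where
    "P ** P' = id_mat" "P' ** P = id_mat"
    "Q ** Q' = id_mat" "Q' ** Q = id_mat"
    "\<And>u v. tmap B' (P *v u) (P *v v) = Q *v tmap B u v"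
proof -
  note sk = tmap_skew[OF skew(1)] and sk' = tmap_skew[OF skew(2)]
  have two: "(2::'k) \<noteq> 0"
  proof
    assume "(2::'k) = 0"
    then have "CHAR('k) dvd 2" using of_nat_eq_0_iff_char_dvd[where ?'a = 'k, of 2] by simp
    then show False
      using p prime_card_field_eq_of_nat(1)[OF p(1,2)] by (metis dvd_refl primes_dvd_imp_eq two_is_prime_nat)
  qed
  have t0 [simp]: "tmap B 0 v = 0" "tmap B v 0 = 0" for v
    using tmap_add_left[of B 0 0 v] tmap_add_right[of B v 0 0] by simp_all
  have t0' [simp]: "tmap B' 0 v = 0" "tmap B' v 0 = 0" for v
    using tmap_add_left[of B' 0 0 v] tmap_add_right[of B' v 0 0] by simp_all
  obtain \<phi> where \<phi>: "\<phi> \<in> Group.iso (G_group B) (G_group B')" using iso by (auto simp: is_iso_def)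
  have bij: "bij \<phi>" using \<phi> by (simp add: iso_def G_group_def)
  have hom: "\<phi> (g \<otimes>\<^bsub>G_group B\<^esub> h) = \<phi> g \<otimes>\<^bsub>G_group B'\<^esub> \<phi> h" for g h
    using \<phi> by (intro hom_mult[of _ "G_group B"]) (simp_all add: iso_def G_group_def)
  define \<alpha> where "\<alpha> v w = fst (\<phi> (v, w))" for v w
  define \<beta> where "\<beta> v w = snd (\<phi> (v, w))" for v w
  have \<alpha>_mult: "\<alpha> (v + v') (w + w' + (1/2) *s tmap B v v') = \<alpha> v w + \<alpha> v' w'"
    and \<beta>_mult: "\<beta> (v + v') (w + w' + (1/2) *s tmap B v v') =
      \<beta> v w + \<beta> v' w' + (1/2) *s tmap B' (\<alpha> v w) (\<alpha> v' w')" for v v' w w'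
    using hom[of "(v, w)" "(v', w')"] by (simp_all add: G_group_def \<alpha>_def \<beta>_def case_prod_unfold)
  define c where "c = \<alpha> 0"
  define \<psi> where "\<psi> = \<beta> 0"
  define a where "a v = \<alpha> v 0" for v
  have \<alpha>_split: "\<alpha> v (w + w') = \<alpha> v w + c w'" for v w w'
    using \<alpha>_mult[of v 0 w w'] by (simp add: c_def)
  have \<beta>_split: "\<beta> v (w + w') = \<beta> v w + \<psi> w' + (1/2) *s tmap B' (\<alpha> v w) (c w')" for v w w'
    using \<beta>_mult[of v 0 w w'] by (simp add: c_def \<psi>_def)
  have half: "(1/2) *s x + (1/2) *s x = x" for x :: "'k ^ 'd"
    using two by (simp add: vec.scale_left_distrib[symmetric])
  have comm: "w + w' + (1/2) *s tmap B v v' = (w' + w + (1/2) *s tmap B v' v) + tmap B v v'" for v v' w w'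
    using half[of "tmap B v v'"] sk[of v' v] by (simp add: algebra_simps vec.scale_minus_right)
  have c_t: "c (tmap B v v') = 0" for v v'
    using \<alpha>_mult[of v v' 0 0] \<alpha>_mult[of v' v 0 0] comm[of 0 0 v v']
      \<alpha>_split[of "v + v'" "0 + 0 + (1/2) *s tmap B v' v" "tmap B v v'"] by (simp add: add.commute)
  have t_\<alpha>: "tmap B' (\<alpha> v w) (\<alpha> v' w') = \<psi> (tmap B v v')" for v v' w w'
  proof -
    have "\<beta> v w + \<beta> v' w' + (1/2) *s tmap B' (\<alpha> v w) (\<alpha> v' w') =
        \<beta> (v + v') ((w' + w + (1/2) *s tmap B v' v) + tmap B v v')"
      by (simp only: \<beta>_mult[symmetric] comm[of w w' v v', symmetric])
    also have "\<dots> = \<beta> (v' + v) (w' + w + (1/2) *s tmap B v' v) + \<psi> (tmap B v v')"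
      by (subst \<beta>_split) (simp add: c_t add.commute)
    also have "\<dots> = \<beta> v' w' + \<beta> v w + (1/2) *s tmap B' (\<alpha> v' w') (\<alpha> v w) + \<psi> (tmap B v v')"
      by (simp only: \<beta>_mult)
    finally have "\<psi> (tmap B v v') = (1/2) *s tmap B' (\<alpha> v w) (\<alpha> v' w') + (1/2) *s tmap B' (\<alpha> v w) (\<alpha> v' w')"
      using sk'[of "\<alpha> v' w'" "\<alpha> v w"] by (simp add: algebra_simps vec.scale_minus_right)
    then show ?thesis by (simp add: half)
  qed
  have \<psi>0: "\<psi> 0 = 0" using \<beta>_split[of 0 0 0] c_t[of 0 0] by (simp add: \<psi>_def)
  have sur: "\<exists>v w. \<alpha> v w = u" for u
    using bij by (metis \<alpha>_def bij_pointE fst_conv surj_pair)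
  \<comment> \<open>The elements \<open>(0, w)\<close> are central, so their images are central, too.\<close>
  have c_central: "tmap B' (c w) u = 0" "tmap B' u (c w) = 0" for w u
  proof -
    obtain x y where "\<alpha> x y = u" using sur by blast
    then show "tmap B' (c w) u = 0" using t_\<alpha>[of 0 w x y] by (simp add: c_def \<psi>0)
    then show "tmap B' u (c w) = 0" using sk'[of u "c w"] by simp
  qed
  have \<psi>_lin: "Vector_Spaces.linear (*s) (*s) \<psi>"
  proof (rule additive_imp_linear[OF p(1,2)])
    show "\<psi> (x + y) = \<psi> x + \<psi> y" for x y
      using \<beta>_split[of 0 x y] by (simp only: \<psi>_def[symmetric] c_central vec.scale_zero_right add_0_right)
  qed
  have c_lin: "Vector_Spaces.linear (*s) (*s) c"
  proof (rule additive_imp_linear[OF p(1,2)])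
    show "c (x + y) = c x + c y" for x y
      using \<alpha>_split[of 0 x y] by (simp only: c_def[symmetric])
  qed
  have a_lin: "Vector_Spaces.linear (*s) (*s) a"
  proof (rule additive_imp_linear[OF p(1,2)])
    fix x y
    \<comment> \<open>The half-commutator is a multiple of a value of \<open>t\<close>, where \<open>c\<close> vanishes.\<close>
    have "a (x + y) + c ((1/2) *s tmap B x y) = a x + a y"
      using \<alpha>_mult[of x y 0 0] \<alpha>_split[of "x + y" 0 "0 + (1/2) *s tmap B x y"]
      by (simp add: a_def add.assoc)
    then show "a (x + y) = a x + a y" by (simp add: vec.linear_scale[OF c_lin] c_t)
  qed
  define T where "T = {tmap B v v' | v v'. True}"
  have tT: "tmap B v v' \<in> T" for v v' unfolding T_def by blast
  have "T \<subseteq> {w. c w = 0}" by (auto simp: T_def c_t)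
  then have span_T: "vec.span T \<subseteq> {w. c w = 0}"
    by (rule vec.span_minimal) (auto intro!: vec.subspaceI
      simp: vec.linear_0[OF c_lin] vec.linear_add[OF c_lin] vec.linear_scale[OF c_lin])
  have "inj_on \<psi> (vec.span T)"
  proof (rule inj_onI)
    fix x y assume "x \<in> vec.span T" "y \<in> vec.span T" and eq: "\<psi> x = \<psi> y"
    then have "x \<in> {w. c w = 0}" "y \<in> {w. c w = 0}" using span_T by blast+
    with eq have "\<phi> (0, x) = \<phi> (0, y)" by (simp add: prod_eq_iff \<psi>_def \<beta>_def c_def \<alpha>_def)
    then show "x = y" using bij by (auto dest: bij_is_inj injD)
  qed
  then obtain Q Q' where Q: "Q ** Q' = id_mat" "Q' ** Q = id_mat"
    and Q_eq: "\<And>w. w \<in> T \<Longrightarrow> Q *v w = \<psi> w"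
    using linear_extend_invertible_subspace[OF \<psi>_lin] by blast
  \<comment> \<open>The map \<open>a\<close> sends the radical of \<open>t\<close>, and nothing else, to the radical of \<open>t'\<close>.\<close>
  define R where "R = {v. \<forall>u. tmap B v u = 0}"
  define R' where "R' = {v. \<forall>u. tmap B' v u = 0}"
  have R: "vec.subspace R" and R': "vec.subspace R'"
    by (auto intro!: vec.subspaceI simp: R_def R'_def tmap_add_left tmap_scale_left)
  have cR': "c w \<in> R'" for w by (simp add: R'_def c_central)
  have \<alpha>_eq: "\<alpha> x y = a x + c y" for x y using \<alpha>_split[of x 0 y] by (simp add: a_def)
  have aa: "tmap B' (a v) (a u) = \<psi> (tmap B v u)" for u v
    using t_\<alpha>[of v 0 u 0] by (simp add: a_def)
  have \<psi>_0_iff: "\<psi> (tmap B v u) = 0 \<longleftrightarrow> tmap B v u = 0" for u v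
    using inj_onD[OF \<open>inj_on \<psi> (vec.span T)\<close>, of "tmap B v u" 0] vec.span_base[of "tmap B v u" T] vec.span_zero[of T]
    by (auto simp: tT \<psi>0)
  have iff: "a v \<in> R' \<longleftrightarrow> v \<in> R" for v
  proof
    assume "a v \<in> R'"
    then have "\<psi> (tmap B v u) = 0" for u by (simp add: R'_def aa[symmetric])
    then show "v \<in> R" by (simp add: R_def \<psi>_0_iff)
  next
    assume v: "v \<in> R"
    have "tmap B' (a v) u = 0" for u
    proof -
      obtain x y where "u = a x + c y" using sur[of u] \<alpha>_eq by metis
      then show ?thesis using v by (simp add: tmap_add_right c_central aa R_def \<psi>0)
    qed
    then show "a v \<in> R'" by (simp add: R'_def)
  qed
  have "\<exists>v. u - a v \<in> R'" for u
  proof -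
    obtain x y where "u = a x + c y" using sur[of u] \<alpha>_eq by metis
    then show ?thesis using cR'[of y] by (intro exI[of _ x]) simp
  qed
  then obtain P P' where P: "P ** P' = id_mat" "P' ** P = id_mat"
    and P_eq: "\<And>v. P *v v - a v \<in> R'"
    using invertible_lift_of_quotient_iso[OF a_lin R R' iff] by blast
  have "tmap B' (P *v u) (P *v v) = Q *v tmap B u v" for u v
  proof -
    have 1: "tmap B' (P *v u) z = tmap B' (a u) z" for u z
      using P_eq[of u] tmap_add_left[of B' "P *v u - a u" "a u" z] by (simp add: R'_def)
    have 2: "tmap B' z (P *v v) = tmap B' z (a v)" for z
      using 1[of v z] sk'[of z "P *v v"] sk'[of z "a v"] by simp
    show ?thesis using Q_eq[of "tmap B u v"] by (simp add: 1 2 aa tT)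
  qed
  with P Q that show ?thesis by blast
qed

section \<open>Matrices of linear forms of isometric maps\<close>

lemma mdeg_1_imp_single: "mdeg m = 1 \<Longrightarrow> \<exists>i. m = Poly_Mapping.single i 1"
proof -
  assume "mdeg m = 1"
  then obtain i where i: "Poly_Mapping.lookup m i = 1" "\<And>j. j \<noteq> i \<Longrightarrow> Poly_Mapping.lookup m j = 0"
    using sum_eq_1_iff[of UNIV "Poly_Mapping.lookup m"] unfolding mdeg_def by auto
  have "m = Poly_Mapping.single i 1"
    by (rule poly_mapping_eqI) (auto simp: lookup_single when_def i)
  then show ?thesis ..
qed

lemma linear_form_eq_sum:
  assumes "linear_form f"
  shows "f = (\<Sum>i\<in>UNIV. Poly_Mapping.single (Poly_Mapping.single i 1)
           (Poly_Mapping.lookup f (Poly_Mapping.single i 1)))" (is "f = ?g")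
proof (rule poly_mapping_eqI)
  have inj: "Poly_Mapping.single i (1::nat) = Poly_Mapping.single j 1 \<longleftrightarrow> i = j" for i j :: 'a
    by (metis lookup_single_eq lookup_single_not_eq one_neq_zero)
  fix m
  have R: "Poly_Mapping.lookup ?g m =
      (\<Sum>i\<in>UNIV. if Poly_Mapping.single i 1 = m then Poly_Mapping.lookup f m else 0)"
    unfolding lookup_sum by (rule sum.cong) (auto simp: lookup_single when_def)
  show "Poly_Mapping.lookup f m = Poly_Mapping.lookup ?g m"
  proof (cases "mdeg m = 1")
    case True
    then obtain j where m: "m = Poly_Mapping.single j 1" using mdeg_1_imp_single by blast
    show ?thesis unfolding R unfolding m inj by simp
  next
    case False
    then have "Poly_Mapping.lookup f m = 0"
      using assms by (auto simp: linear_form_def hom_poly_def in_keys_iff)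
    then show ?thesis unfolding R by (auto intro!: sum.neutral)
  qed
qed

lemma lookup_linear_form:
  assumes "linear_form f"
  shows "Poly_Mapping.lookup f (Poly_Mapping.single j 1) = peval f (axis j 1)"
proof -
  let ?g = "\<Sum>i\<in>UNIV. Poly_Mapping.single (Poly_Mapping.single i 1) (Poly_Mapping.lookup f (Poly_Mapping.single i 1))"
  interpret comm_ring_hom "\<lambda>f. peval f (axis j 1)" by (rule peval_hom)
  have "peval ?g (axis j 1) = (\<Sum>i\<in>UNIV. if i = j then Poly_Mapping.lookup f (Poly_Mapping.single j 1) else 0)"
    unfolding hom_sum peval_mdeg_1_imp_singlemial by (rule sum.cong) (auto simp: axis_def)
  then show ?thesis unfolding linear_form_eq_sum[OF assms, symmetric] by simp
qed

text \<open>The linear form with coefficients \<open>c\<close>. All matrices below have entries of this form, and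
  identities between them reduce to identities between coefficients.\<close>

definition lin_poly :: "('e::finite \<Rightarrow> 'k::comm_ring_1) \<Rightarrow> ('e, 'k) mpoly" where
  "lin_poly c = (\<Sum>i\<in>UNIV. Poly_Mapping.single (Poly_Mapping.single i 1) (c i))"

lemma sum_lin_poly: "(\<Sum>x\<in>A. lin_poly (c x)) = lin_poly (\<lambda>i. \<Sum>x\<in>A. c x i)"
  unfolding lin_poly_def single_sum by (rule sum.swap)

lemma const_mult_lin_poly: "Poly_Mapping.single 0 k * lin_poly c = lin_poly (\<lambda>i. k * c i)"
  unfolding lin_poly_def by (simp add: sum_distrib_left mult_single)

lemma lin_poly_mult_const: "lin_poly c * Poly_Mapping.single 0 k = lin_poly (\<lambda>i. c i * k)"
  unfolding lin_poly_def by (simp add: sum_distrib_right mult_single)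

lemma lsub_lin_poly: "lsub M (lin_poly c) = lin_poly (\<lambda>j. \<Sum>i\<in>UNIV. c i * M $ i $ j)"
proof -
  interpret comm_ring_hom "lsub M" by (rule lsub_hom)
  have "lsub M (lin_poly c) = (\<Sum>i\<in>UNIV. lin_poly (\<lambda>j. c i * M $ i $ j))"
    unfolding lin_poly_def hom_sum lsub_mdeg_1_imp_singlemial ..
  then show ?thesis by (simp only: sum_lin_poly)
qed

lemma linear_form_eq_lin_poly: "linear_form f \<Longrightarrow> f = lin_poly (\<lambda>i. peval f (axis i 1))"
  unfolding lin_poly_def using linear_form_eq_sum[of f] lookup_linear_form[of f] by simp

lemma adjoint_mat_entry:
  assumes "\<forall>i j. linear_form (B $ i $ j)"
  shows "adjoint_mat B $ i $ \<kappa> = lin_poly (\<lambda>j. peval (B $ i $ j) (axis \<kappa> 1))"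
  using assms by (simp add: adjoint_mat_def lin_poly_def lookup_linear_form)

abbreviation const_mat :: "'k::comm_ring_1 ^ 'n ^ 'm \<Rightarrow> ('e::finite, 'k) mpoly ^ 'n ^ 'm" where
  "const_mat \<equiv> map_entries (Poly_Mapping.single 0)"

lemma const_mat_inverse:
  fixes M N :: "'k::comm_ring_1 ^ 'n ^ 'n"
  assumes "M ** N = id_mat"
  shows "const_mat M ** const_mat N = (id_mat :: ('e::finite, 'k) mpoly ^ 'n ^ 'n)"
proof -
  have "(const_mat M ** const_mat N :: ('e, 'k) mpoly ^ 'n ^ 'n) $ i $ j = Poly_Mapping.single 0 ((M ** N) $ i $ j)" for i j
    by (simp add: matrix_matrix_mult_def map_entries_def single_sum mult_single)
  then show ?thesis
    unfolding assms by (simp add: Finite_Cartesian_Product.vec_eq_iff Finite_Cartesian_Product.mat_def)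
qed

lemma transpose_inverse:
  fixes M N :: "'k::comm_ring_1 ^ 'n ^ 'n"
  assumes "M ** N = id_mat"
  shows "Finite_Cartesian_Product.transpose N ** Finite_Cartesian_Product.transpose M = id_mat"
  using assms by (metis matrix_transpose_mul transpose_mat)

text \<open>The isometry evaluated at a pair of standard basis vectors. Both matrix identities below are
  this relation between coefficients: read as linear forms in \<open>y\<close> for \<open>B\<close>, and with the column
  index \<open>b\<close> turned into the index of the variable for the adjoint.\<close>

lemma isometry_coefficients:
  fixes B B' :: "('d::finite, 'k::field) mpoly ^ 'n::finite ^ 'n"
  assumes "\<And>u v. tmap B' (P *v u) (P *v v) = Q *v tmap B u v"
  shows "(\<Sum>r\<in>UNIV. \<Sum>s\<in>UNIV. P $ r $ a * peval (B' $ r $ s) (axis i 1) * P $ s $ b) =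
    (\<Sum>\<kappa>\<in>UNIV. Q $ i $ \<kappa> * peval (B $ a $ b) (axis \<kappa> 1))"
proof -
  have col: "(P *v axis a 1) $ r = P $ r $ a" for r a
  proof -
    have "P $ r $ j * axis a 1 $ j = (if j = a then P $ r $ a else 0)" for j by (auto simp: axis_def)
    then show ?thesis by (simp add: matrix_vector_mult_def)
  qed
  have "tmap B' (P *v axis a 1) (P *v axis b 1) $ i = (Q *v tmap B (axis a 1) (axis b 1)) $ i"
    by (simp only: assms)
  then show ?thesis
    unfolding tmap_def[of B'] vec_lambda_beta col
    unfolding matrix_vector_mult_def vec_lambda_beta tmap_axis .
qed

context
  fixes B B' :: "('d::finite, 'k::field) mpoly ^ 'n::finite ^ 'n" and P P' Q Q'
  assumes lin: "\<forall>i j. linear_form (B $ i $ j)" and lin': "\<forall>i j. linear_form (B' $ i $ j)"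
    and PP': "P ** P' = id_mat"
    and QQ': "Q ** Q' = id_mat"
    and iso: "\<And>u v. tmap B' (P *v u) (P *v v) = Q *v tmap B u v"
begin

text \<open>This is \<open>B(Q\<^sup>T y) = P\<^sup>T B'(y) P\<close>. The transpose of \<open>Q\<close> appears because \<open>Q\<close> acts on the values of
  \<open>t\<close>, while \<open>y\<close> ranges over linear functionals on these values.\<close>

lemma subst_isometry:
  "map_entries (lsub (Finite_Cartesian_Product.transpose Q)) B =
     Finite_Cartesian_Product.transpose (const_mat P) ** (B' ** const_mat P)"
proof -
  let ?b = "\<lambda>a b \<kappa>. peval (B $ a $ b) (axis \<kappa> 1)" and ?b' = "\<lambda>r s i. peval (B' $ r $ s) (axis i 1)"
  have "lsub (Finite_Cartesian_Product.transpose Q) (B $ a $ b) =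
      (\<Sum>r\<in>UNIV. const_mat P $ r $ a * (\<Sum>s\<in>UNIV. B' $ r $ s * const_mat P $ s $ b))" for a b
  proof -
    have "lsub (Finite_Cartesian_Product.transpose Q) (B $ a $ b) =
        lin_poly (\<lambda>i. \<Sum>\<kappa>\<in>UNIV. Q $ i $ \<kappa> * ?b a b \<kappa>)"
      by (subst linear_form_eq_lin_poly[of "B $ a $ b"])
        (simp_all add: lin lsub_lin_poly Finite_Cartesian_Product.transpose_def mult.commute)
    also have "\<dots> = lin_poly (\<lambda>i. \<Sum>r\<in>UNIV. \<Sum>s\<in>UNIV. P $ r $ a * ?b' r s i * P $ s $ b)"
      by (simp only: isometry_coefficients[OF iso])
    also have "\<dots> = (\<Sum>r\<in>UNIV. \<Sum>s\<in>UNIV. Poly_Mapping.single 0 (P $ r $ a) *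
        (lin_poly (?b' r s) * Poly_Mapping.single 0 (P $ s $ b)))"
      by (simp only: lin_poly_mult_const const_mult_lin_poly sum_lin_poly mult.assoc)
    also have "\<dots> = (\<Sum>r\<in>UNIV. const_mat P $ r $ a * (\<Sum>s\<in>UNIV. B' $ r $ s * const_mat P $ s $ b))"
      by (simp only: linear_form_eq_lin_poly[OF lin'[rule_format], symmetric] map_entries_def
          vec_lambda_beta sum_distrib_left)
    finally show ?thesis .
  qed
  then show ?thesis
    by (simp add: Finite_Cartesian_Product.vec_eq_iff map_entries_def matrix_matrix_mult_def
        Finite_Cartesian_Product.transpose_def)
qed

text \<open>This is \<open>P\<^sup>T B'\<^sup>\<bullet>(P x) = B\<^sup>\<bullet>(x) Q\<^sup>T\<close>. The variables now stand for the second argument of the map,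
  which \<open>P\<close> carries from \<open>t\<close> to \<open>t'\<close>; so the substitution is on the side of \<open>B'\<close>. The columns are
  indexed by the components of the values, on which \<open>Q\<close> acts.\<close>

lemma subst_isometry_adjoint:
  "Finite_Cartesian_Product.transpose (const_mat P) ** map_entries (lsub P) (adjoint_mat B') =
     adjoint_mat B ** Finite_Cartesian_Product.transpose (const_mat Q)"
proof -
  let ?b = "\<lambda>\<kappa> a b. peval (B $ a $ b) (axis \<kappa> 1)" and ?b' = "\<lambda>i r s. peval (B' $ r $ s) (axis i 1)"
  have "(\<Sum>r\<in>UNIV. const_mat P $ r $ a * lsub P (adjoint_mat B' $ r $ \<kappa>)) =
      (\<Sum>\<mu>\<in>UNIV. adjoint_mat B $ a $ \<mu> * const_mat Q $ \<kappa> $ \<mu>)" for a \<kappa>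
  proof -
    have "(\<Sum>r\<in>UNIV. const_mat P $ r $ a * lsub P (adjoint_mat B' $ r $ \<kappa>)) =
        lin_poly (\<lambda>l. \<Sum>r\<in>UNIV. \<Sum>s\<in>UNIV. P $ r $ a * ?b' \<kappa> r s * P $ s $ l)"
      by (simp only: map_entries_def vec_lambda_beta adjoint_mat_entry[OF lin'] lsub_lin_poly
          const_mult_lin_poly sum_lin_poly sum_distrib_left mult.assoc)
    also have "\<dots> = lin_poly (\<lambda>l. \<Sum>\<mu>\<in>UNIV. ?b \<mu> a l * Q $ \<kappa> $ \<mu>)"
      unfolding isometry_coefficients[OF iso] by (simp only: mult.commute)
    also have "\<dots> = (\<Sum>\<mu>\<in>UNIV. adjoint_mat B $ a $ \<mu> * const_mat Q $ \<kappa> $ \<mu>)"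
      by (simp only: map_entries_def vec_lambda_beta adjoint_mat_entry[OF lin] lin_poly_mult_const sum_lin_poly)
    finally show ?thesis .
  qed
  then show ?thesis
    by (simp add: Finite_Cartesian_Product.vec_eq_iff map_entries_def matrix_matrix_mult_def
        Finite_Cartesian_Product.transpose_def)
qed

lemma const_mat_P:
  "const_mat P ** const_mat P' = (id_mat :: ('e::finite, 'k) mpoly ^ 'n ^ 'n)"
  "Finite_Cartesian_Product.transpose (const_mat P') ** Finite_Cartesian_Product.transpose (const_mat P) =
    (id_mat :: ('e::finite, 'k) mpoly ^ 'n ^ 'n)"
  by (simp_all only: transpose_inverse const_mat_inverse[OF PP'])

lemma det_idl_isometry:
  "det_idl B' k = lsub (Finite_Cartesian_Product.transpose Q) ` det_idl B k"
proof -
  have "Q' ** Q = id_mat" using QQ' matrix_left_right_inverse by blast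
  note ring_automorphism.det_idl_map_entries[OF ring_automorphism_lsub[OF transpose_inverse[OF this]], of B k]
  moreover have "det_idl (map_entries (lsub (Finite_Cartesian_Product.transpose Q)) B) k = det_idl B' k"
    unfolding subst_isometry det_idl_mult_left[OF const_mat_P(2)] det_idl_mult_right[OF const_mat_P(1)] ..
  ultimately show ?thesis by simp
qed

lemma det_idl_isometry_adjoint: "det_idl (adjoint_mat B) k = lsub P ` det_idl (adjoint_mat B') k"
proof -
  have "Q' ** Q = id_mat" using QQ' matrix_left_right_inverse by blast
  note Q = transpose_inverse[OF const_mat_inverse[OF this]]
  have "det_idl (map_entries (lsub P) (adjoint_mat B')) k =
      det_idl (Finite_Cartesian_Product.transpose (const_mat P) ** map_entries (lsub P) (adjoint_mat B')) k"
    by (rule det_idl_mult_left[OF const_mat_P(2), symmetric])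
  also have "\<dots> = det_idl (adjoint_mat B) k"
    unfolding subst_isometry_adjoint by (rule det_idl_mult_right[OF Q])
  finally show ?thesis
    by (simp only: ring_automorphism.det_idl_map_entries[OF ring_automorphism_lsub[OF PP']])
qed

end

section \<open>Isomorphism invariance of the ideal rank vectors\<close>

lemma irk_nth:
  fixes D :: "'a::comm_ring_1 ^ 'n ^ 'm"
  assumes "k \<in> {1..min CARD('m) CARD('n)}"
  shows "irk D ! (k - 1) = det_idl D k"
  using assms unfolding irk_def by (subst nth_map) (auto simp: nth_upt simp del: upt_Suc)

theorem theorem2p3:
  fixes p :: nat
    and B B' :: "('d::finite, 'k::field) mpoly ^ 'n::finite ^ 'n"
  assumes "prime p" "odd p" "CARD('k) = p"
    and "\<forall>i j. linear_form (B $ i $ j)" "Finite_Cartesian_Product.transpose B = - B"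
    and "\<forall>i j. linear_form (B' $ i $ j)" "Finite_Cartesian_Product.transpose B' = - B'"
    and "G_group B \<cong> G_group B'"
  shows "\<forall>k\<in>{1..CARD('n)}. \<forall>l\<in>{1..min CARD('n) CARD('d)}.
    (let I = irk B ! (k - 1); I' = irk B' ! (k - 1);
         J = irk (adjoint_mat B) ! (l - 1); J' = irk (adjoint_mat B') ! (l - 1)
     in
       \<comment> \<open>(1)\<close>
       (idl_degree I = idl_degree I' \<and> idl_dim I = idl_dim I' \<and>
        idl_degree J = idl_degree J' \<and> idl_dim J = idl_dim J') \<and>
       \<comment> \<open>(2)\<close>
       (primary_data I = primary_data I' \<and> primary_data J = primary_data J') \<and>
       \<comment> \<open>(3)\<close>
       (var_degree (Vaff I) = var_degree (Vaff I') \<and>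
        card (Vaff_rat I) = card (Vaff_rat I') \<and>
        card (var_components I) = card (var_components I') \<and>
        card (var_geom_components I) = card (var_geom_components I') \<and>
        var_degree (Vaff J) = var_degree (Vaff J') \<and>
        card (Vaff_rat J) = card (Vaff_rat J') \<and>
        card (var_components J) = card (var_components J') \<and>
        card (var_geom_components J) = card (var_geom_components J')) \<and>
       \<comment> \<open>(4)\<close>
       (vec.dim (vec.span (Vaff_rat I)) = vec.dim (vec.span (Vaff_rat I')) \<and>
        vec.dim (vec.span (Vaff_rat J)) = vec.dim (vec.span (Vaff_rat J'))))"
proof -
  obtain P P' :: "'k ^ 'n ^ 'n" and Q Q' :: "'k ^ 'd ^ 'd" where
    P: "P ** P' = id_mat" and
    Q: "Q ** Q' = id_mat" "Q' ** Q = id_mat" and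
    iso: "\<And>u v. tmap B' (P *v u) (P *v v) = Q *v tmap B u v"
    by (rule group_iso_imp_isometry[OF assms(1,3,2,5,7,8)]) blast
  note inv = lsub_invariants[OF transpose_inverse[OF Q(2)]] lsub_invariants[OF P]
  note I' = det_idl_isometry[OF assms(4,6) P Q(1) iso]
  note J = det_idl_isometry_adjoint[OF assms(4,6) P Q(1) iso]
  show ?thesis
  proof (intro ballI, goal_cases)
    case (1 k l)
    then have k: "k \<in> {1..min CARD('n) CARD('n)}" by simp
    show ?case
      by (simp only: Let_def irk_nth[OF k] irk_nth[OF 1(2)] I' J inv simp_thms)
  qed
qed

end
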